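(* Let $I \subset S$ be any bihomogeneous ideal and let $(a,b) \in \operatorname{x-reg}(I) \cap (\mathbb{Z}_{>0}\times\mathbb{Z}_{\geq 0})$. Then $(a + n + 1,b + m + 1) \notin \beta_{i}(I)$ for all $i \geq 1$.
   Context: Let $\mathbf{k}$ be a field of characteristic $0$ and $S=\mathbf{k}[x_0,\dots,x_n,y_0,\dots,y_m]$ with the standard $\mathbb{Z}^2$-grading $\deg(x_i)=(1,0)$, $\deg(y_j)=(0,1)$. An ideal of $S$ is bihomogeneous if it is generated by bihomogeneous polynomials. For pairs in $\mathbb{Z}^2$, $(a',b')\geq(a,b)$ means $a'\geq a$ and $b'\geq b$. Let $\mathfrak{m}_x=(x_0,\dots,x_n)$, and let $H^i_{\mathfrak{m}_x}$ denote local cohomology with respect to $\mathfrak{m}_x$. The partial regularity region $\operatorname{x-reg}(I)$ is the set of $(a,b)\in\mathbb{Z}^2$ such that for all $i\geq 1$ and all $(a',b')\geq(a-i+1,b)$ one has $H^i_{\mathfrak{m}_x}(I)_{(a',b')}=0$. Let $F_\bullet$ be the minimal bigraded free resolution of $I$ (as an $S$-module), $F_i=\bigoplus_{(a,b)\in\mathbb{Z}^2}S(-a,-b)^{\beta_{i,(a,b)}}$, where $S(-a,-b)_{(a',b')}=S_{(a'-a,b'-b)}$. Then $\beta_i(I)=\{(a,b)\in\mathbb{Z}^2 : \beta_{i,(a,b)}\neq 0\}$. *)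

theory Defs
  imports "HOL-Library.Poly_Mapping" "HOL-Library.Cardinality" "Jordan_Normal_Form.Matrix"
begin

text \<open>
  The variables \<open>x\<^sub>0, \<dots>, x\<^sub>n\<close> are indexed by a finite type \<open>'x\<close> with \<open>n + 1\<close> elements and
  \<open>y\<^sub>0, \<dots>, y\<^sub>m\<close> by a finite type \<open>'y\<close> with \<open>m + 1\<close> elements, so the whole type
  \<open>('x, 'y, 'k) bipoly\<close> is the ring \<open>S\<close>. Laurent polynomials are used as the common overring of the
  localizations of \<open>S\<close> at products of the variables \<open>x\<^sub>i\<close>.
\<close>

type_synonym ('x, 'y, 'k) bipoly = "(('x + 'y) \<Rightarrow>\<^sub>0 nat) \<Rightarrow>\<^sub>0 'k"
type_synonym ('x, 'y, 'k) bilaurent = "(('x + 'y) \<Rightarrow>\<^sub>0 int) \<Rightarrow>\<^sub>0 'k"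

definition bideg :: "(('x::finite + 'y::finite) \<Rightarrow>\<^sub>0 int) \<Rightarrow> int \<times> int" where
  "bideg e = ((\<Sum>i\<in>UNIV. Poly_Mapping.lookup e (Inl i)), (\<Sum>j\<in>UNIV. Poly_Mapping.lookup e (Inr j)))"

text \<open>The zero polynomial is bihomogeneous of every bidegree.\<close>

definition laurent_bihomogeneous ::
    "int \<times> int \<Rightarrow> ('x::finite, 'y::finite, 'k::zero) bilaurent \<Rightarrow> bool" where
  "laurent_bihomogeneous d f \<longleftrightarrow> (\<forall>e\<in>Poly_Mapping.keys f. bideg e = d)"

definition bihomogeneous ::
    "int \<times> int \<Rightarrow> ('x::finite, 'y::finite, 'k::zero) bipoly \<Rightarrow> bool" where
  "bihomogeneous d f \<longleftrightarrow> (\<forall>e\<in>Poly_Mapping.keys f. bideg (Poly_Mapping.map int e) = d)"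

abbreviation ideal_span :: "'a::comm_ring_1 set \<Rightarrow> 'a set" where
  "ideal_span \<equiv> Modules.module.span (*)"

definition bihomogeneous_ideal ::
    "('x::finite, 'y::finite, 'k::field) bipoly set \<Rightarrow> bool" where
  "bihomogeneous_ideal I \<longleftrightarrow> (\<exists>G. (\<forall>g\<in>G. \<exists>d. bihomogeneous d g) \<and> I = ideal_span G)"


section \<open>Local cohomology of an ideal with respect to the x-variables\<close>

definition to_laurent :: "('x, 'y, 'k::field) bipoly \<Rightarrow> ('x, 'y, 'k) bilaurent" where
  "to_laurent f = (\<Sum>e\<in>Poly_Mapping.keys f.
     Poly_Mapping.single (Poly_Mapping.map int e) (Poly_Mapping.lookup f e))"

text \<open>
  The localization of \<open>I\<close> at \<open>x\<^sub>A\<close>, the product of the \<open>x\<^sub>i\<close> with \<open>i \<in> A\<close>: all fractions \<open>f / x\<^sub>A\<^sup>t\<close>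
  with \<open>f \<in> I\<close>. Since \<open>S\<close> is a domain it embeds into the Laurent polynomials.
\<close>

definition x_localization ::
    "('x, 'y, 'k::field) bipoly set \<Rightarrow> 'x set \<Rightarrow> ('x, 'y, 'k) bilaurent set" where
  "x_localization I A =
     {Poly_Mapping.single (\<Sum>i\<in>A. Poly_Mapping.single (Inl i) (- int t)) 1 * to_laurent f
      | f t. f \<in> I}"

text \<open>
  The strand of bidegree \<open>d\<close> of the Cech complex of \<open>I\<close> on \<open>x\<^sub>0, \<dots>, x\<^sub>n\<close>; a cochain in
  cohomological degree \<open>p\<close> has one component in the localization at \<open>x\<^sub>A\<close> for every \<open>p\<close>-element
  set \<open>A\<close>, and is set to \<open>0\<close> at all other \<open>A\<close>. The complex starts with \<open>I\<close> itself in cohomological degree \<open>0\<close>,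
  and its cohomology is the local cohomology with respect to the ideal generated by the \<open>x\<^sub>i\<close>.
\<close>

definition cech_cochains ::
    "('x::finite, 'y::finite, 'k::field) bipoly set \<Rightarrow> nat \<Rightarrow> int \<times> int
     \<Rightarrow> ('x set \<Rightarrow> ('x, 'y, 'k) bilaurent) set" where
  "cech_cochains I p d =
     {c. \<forall>A. if card A = p then c A \<in> x_localization I A \<and> laurent_bihomogeneous d (c A)
             else c A = 0}"

definition cech_diff ::
    "('x::{finite,linorder} set \<Rightarrow> ('x, 'y, 'k::field) bilaurent)
     \<Rightarrow> 'x set \<Rightarrow> ('x, 'y, 'k) bilaurent" where
  "cech_diff c = (\<lambda>B. \<Sum>j\<in>B. (- 1) ^ card {k\<in>B. k < j} * c (B - {j}))"

definition cech_cocycles ::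
    "('x::{finite,linorder}, 'y::finite, 'k::field) bipoly set \<Rightarrow> nat \<Rightarrow> int \<times> int
     \<Rightarrow> ('x set \<Rightarrow> ('x, 'y, 'k) bilaurent) set" where
  "cech_cocycles I i d = {c \<in> cech_cochains I i d. cech_diff c = (\<lambda>_. 0)}"

definition cech_coboundaries ::
    "('x::{finite,linorder}, 'y::finite, 'k::field) bipoly set \<Rightarrow> nat \<Rightarrow> int \<times> int
     \<Rightarrow> ('x set \<Rightarrow> ('x, 'y, 'k) bilaurent) set" where
  "cech_coboundaries I i d =
     (case i of 0 \<Rightarrow> {\<lambda>_. 0} | Suc p \<Rightarrow> cech_diff ` cech_cochains I p d)"

definition x_local_cohomology ::
    "('x::{finite,linorder}, 'y::finite, 'k::field) bipoly set \<Rightarrow> nat \<Rightarrow> int \<times> int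
     \<Rightarrow> ('x set \<Rightarrow> ('x, 'y, 'k) bilaurent) set set" where
  "x_local_cohomology I i d = cech_cocycles I i d //
     {(u, v). u \<in> cech_cocycles I i d \<and> v \<in> cech_cocycles I i d
              \<and> (\<lambda>A. u A - v A) \<in> cech_coboundaries I i d}"

text \<open>The group of coboundaries is the zero class, so the equation below says that the bidegree
  \<open>(a', b')\<close> part of the \<open>i\<close>-th local cohomology vanishes.\<close>

definition x_reg ::
    "('x::{finite,linorder}, 'y::finite, 'k::field) bipoly set \<Rightarrow> (int \<times> int) set" where
  "x_reg I = {(a, b). \<forall>i\<ge>1. \<forall>a' b'. a' \<ge> a - int i + 1 \<and> b' \<ge> b \<longrightarrow>
     x_local_cohomology I i (a', b') = {cech_coboundaries I i (a', b')}}"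


section \<open>Minimal bigraded free resolutions\<close>

definition irrelevant_ideal :: "('x, 'y, 'k::field) bipoly set" where
  "irrelevant_ideal =
     ideal_span {Poly_Mapping.single (Poly_Mapping.single v 1) 1 | v. v \<in> UNIV}"

text \<open>
  \<open>F\<^sub>i\<close> is the direct sum of the \<open>S(-d)\<close> with \<open>d\<close> running through the list \<open>ds i\<close>; its elements are the
  vectors over \<open>S\<close> of length \<open>length (ds i)\<close>. The vector \<open>g\<close> is the augmentation from \<open>F\<^sub>0\<close> onto \<open>I\<close>, and
  \<open>D i\<close> is the matrix of the differential from \<open>F\<^sub>i\<^sub>+\<^sub>1\<close> to \<open>F\<^sub>i\<close>. The maps preserve bidegrees when the
  entries of these matrices are bihomogeneous of the stated bidegrees, and minimality says that the
  image of each \<open>D i\<close> lies in the multiple of \<open>F\<^sub>i\<close> by the ideal of all variables.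
\<close>

definition minimal_bigraded_free_resolution ::
    "('x::finite, 'y::finite, 'k::field) bipoly set \<Rightarrow> (nat \<Rightarrow> (int \<times> int) list)
     \<Rightarrow> ('x, 'y, 'k) bipoly vec \<Rightarrow> (nat \<Rightarrow> ('x, 'y, 'k) bipoly mat) \<Rightarrow> bool" where
  "minimal_bigraded_free_resolution I ds g D \<longleftrightarrow>
     g \<in> carrier_vec (length (ds 0)) \<and>
     (\<forall>i. D i \<in> carrier_mat (length (ds i)) (length (ds (Suc i)))) \<and>
     (\<forall>k < length (ds 0). bihomogeneous (ds 0 ! k) (g $ k)) \<and>
     (\<forall>i. \<forall>k < length (ds i). \<forall>l < length (ds (Suc i)).
        bihomogeneous (fst (ds (Suc i) ! l) - fst (ds i ! k), snd (ds (Suc i) ! l) - snd (ds i ! k))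
          (D i $$ (k, l))) \<and>
     {g \<bullet> v | v. v \<in> carrier_vec (length (ds 0))} = I \<and>
     {v \<in> carrier_vec (length (ds 0)). g \<bullet> v = 0}
       = {D 0 *\<^sub>v w | w. w \<in> carrier_vec (length (ds 1))} \<and>
     (\<forall>i. {v \<in> carrier_vec (length (ds (Suc i))). D i *\<^sub>v v = 0\<^sub>v (length (ds i))}
       = {D (Suc i) *\<^sub>v w | w. w \<in> carrier_vec (length (ds (Suc (Suc i))))}) \<and>
     (\<forall>i. \<forall>k < length (ds i). \<forall>l < length (ds (Suc i)). D i $$ (k, l) \<in> irrelevant_ideal)"

text \<open>
  The multiplicity of \<open>S(-d)\<close> in \<open>F\<^sub>i\<close> is \<open>count_list (ds i) d\<close>. A minimal bigraded free resolution exists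
  for every bihomogeneous ideal and is unique up to isomorphism, so the choice of one is immaterial.
\<close>

definition betti_degrees ::
    "('x::finite, 'y::finite, 'k::field) bipoly set \<Rightarrow> nat \<Rightarrow> (int \<times> int) set" where
  "betti_degrees I i =
     {d. \<exists>ds g D. minimal_bigraded_free_resolution I ds g D \<and> count_list (ds i) d \<noteq> 0}"

end

theory Submission
  imports Defs "HOL-Library.Function_Algebras" "HOL-Library.Product_Plus"
begin

text \<open>
  Put \<open>d = (a + n + 1, b + m + 1)\<close>, and let \<open>K\<close> be the Koszul complex on all \<open>n + m + 2\<close> variables. The
  multiplicity of \<open>S(-d)\<close> in \<open>F\<^sub>i\<close> is the dimension of the degree \<open>d\<close> part of the homology of \<open>K \<otimes> I\<close> in
  degree \<open>i\<close>, so the point is that \<open>K \<otimes> I\<close> is exact in degree \<open>d\<close>. The coefficient of a Koszul chain of degree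
  \<open>d\<close> at a set \<open>A\<close> of variables has degree \<open>d\<close> minus the degree of \<open>A\<close>, which is at least \<open>(a, b)\<close>
  (\<open>strand_ge\<close>). In these degrees the local cohomology of \<open>I\<close> vanishes in all positive cohomological degrees,
  so the Cech complex of \<open>I\<close> is exact there.

  Each localization in a positive degree of the Cech complex has an invertible variable, and therefore an exact Koszul
  complex. Cutting the Cech complex into short exact sequences \<open>0 \<rightarrow> Z\<^sup>p \<rightarrow> C\<^sup>p \<rightarrow> Z\<^sup>p\<^sup>+\<^sup>1 \<rightarrow> 0\<close>, Koszul exactness
  descends from the zero group beyond the end of the Cech complex to \<open>Z\<^sup>1\<close>, which is isomorphic to \<open>I\<close> in the
  relevant degrees (\<open>koszul_exact_cech_cocycles\<close>, \<open>koszul_exact_ideal_strand\<close>).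

  The minimal resolution is cut in the same way into sequences \<open>0 \<rightarrow> Z\<^sub>i\<^sub>+\<^sub>1 \<rightarrow> F\<^sub>i\<^sub>+\<^sub>1 \<rightarrow> Z\<^sub>i \<rightarrow> 0\<close>. Over a free
  module a Koszul cycle bounds as soon as it has no constant term at the empty set, and by minimality the
  cycles of syzygies are of this kind; so exactness passes from \<open>I\<close> to all syzygies (\<open>koszul_exact_syzygy\<close>). In
  homological degree \<open>0\<close> this says that no minimal generator of a syzygy module has degree \<open>d\<close>, which is the
  claim (\<open>degree_not_in_resolution\<close>). Both halves use the same dimension shift, \<open>koszul_exact_kernel\<close>.
\<close>

section \<open>Koszul complexes of commuting operators\<close>

text \<open>
  A chain of the Koszul complex on the operators \<open>X v\<close>, with \<open>v\<close> in \<open>vs\<close>, is a function \<open>c\<close> on sets of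
  variables; \<open>c A\<close> is the coefficient of the wedge product of the basis vectors indexed by \<open>A\<close>. Chains of all
  homological degrees live in the same type, so that exactness can be stated without a homological
  index. The sign of the term for \<open>v\<close> is given by the number of elements of \<open>A\<close> before \<open>v\<close> in the list,
  which makes the complex for \<open>v # vs\<close> the mapping cone of \<open>X v\<close> on the complex for \<open>vs\<close>.
\<close>

primrec koszul :: "('v \<Rightarrow> 'a \<Rightarrow> 'a) \<Rightarrow> 'v list \<Rightarrow> ('v set \<Rightarrow> 'a::ab_group_add) \<Rightarrow> 'v set \<Rightarrow> 'a" where
  "koszul X [] c = (\<lambda>A. 0)"
| "koszul X (v # vs) c =
     (\<lambda>A. if v \<in> A then - koszul X vs c A else X v (c (insert v A)) + koszul X vs c A)"

text \<open>
  Wedging with the basis vector of \<open>v\<close> after applying \<open>L\<close> to the coefficients. When \<open>L\<close> is a one-sided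
  inverse of \<open>X v\<close>, this is the homotopy that contracts the Koszul complex in the direction of \<open>v\<close>.
\<close>

primrec contraction :: "'v \<Rightarrow> ('a \<Rightarrow> 'a) \<Rightarrow> 'v list \<Rightarrow> ('v set \<Rightarrow> 'a::ab_group_add) \<Rightarrow> 'v set \<Rightarrow> 'a" where
  "contraction v L [] c = (\<lambda>A. 0)"
| "contraction v L (w # ws) c =
     (if w = v then (\<lambda>A. if v \<in> A then L (c (A - {v})) else 0)
      else (\<lambda>A. if w \<in> A then - contraction v L ws c A else contraction v L ws c A))"

locale commuting_operators =
  fixes X :: "'v \<Rightarrow> 'a::ab_group_add \<Rightarrow> 'a"
  assumes additive: "additive (X v)"
    and commute: "X v (X w z) = X w (X v z)"
begin

lemmas X_add = additive.add[OF additive] and X_diff = additive.diff[OF additive]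
  and X_minus = additive.minus[OF additive] and X_zero = additive.zero[OF additive]

lemma koszul_zero: "koszul X vs 0 = 0"
  by (induction vs) (auto simp: X_zero fun_eq_iff)

lemma koszul_add: "koszul X vs (c + c') = koszul X vs c + koszul X vs c'"
  by (induction vs) (auto simp: X_add fun_eq_iff)

lemma koszul_minus: "koszul X vs (- c) = - koszul X vs c"
  by (induction vs) (auto simp: X_minus fun_eq_iff)

lemma koszul_diff: "koszul X vs (c - c') = koszul X vs c - koszul X vs c'"
  using koszul_add[of vs c "- c'"] koszul_minus[of vs c'] by simp

text \<open>
  The differential for \<open>vs\<close> never adds or removes a variable outside \<open>vs\<close>. This lets an induction over the list
  treat membership of the head variable as a constant.
\<close>

lemma koszul_cong:
  assumes "v \<notin> set vs" "\<And>B. v \<in> B \<longleftrightarrow> v \<in> A \<Longrightarrow> c B = c' B"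
  shows "koszul X vs c A = koszul X vs c' A"
  using assms
proof (induction vs arbitrary: A)
  case (Cons w vs)
  have "koszul X vs c A = koszul X vs c' A" using Cons by auto
  moreover have "c (insert w A) = c' (insert w A)" using Cons.prems by auto
  ultimately show ?case by simp
qed simp

text \<open>
  In the mapping cone description, \<open>X v\<close> is a chain map on the complex for \<open>vs\<close>; here its effect is read
  off on the chain \<open>\<lambda>A. c (insert v A)\<close>.
\<close>

lemma koszul_insert:
  assumes "v \<notin> set vs"
  shows "koszul X vs (\<lambda>A. X v (c (insert v A))) A = X v (koszul X vs c (insert v A))"
  using assms
  by (induction vs arbitrary: A) (auto simp: X_zero X_minus X_add commute insert_commute)

text \<open>
  A mapping cone is a complex: the two mixed terms \<open>X v \<circ> koszul X vs\<close> and \<open>koszul X vs \<circ> X v\<close> arise with opposite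
  signs and cancel because the operators commute.
\<close>

lemma koszul_koszul:
  assumes "distinct vs"
  shows "koszul X vs (koszul X vs c) = 0"
  using assms
proof (induction vs)
  case (Cons v vs)
  then have IH: "koszul X vs (koszul X vs c) A = 0" and v: "v \<notin> set vs" for A
    by (simp_all add: fun_eq_iff)
  show ?case
  proof
    fix A
    show "koszul X (v # vs) (koszul X (v # vs) c) A = 0 A"
    proof (cases "v \<in> A")
      case True
      have "koszul X vs (koszul X (v # vs) c) A = koszul X vs (- koszul X vs c) A"
        using v True by (intro koszul_cong) auto
      then show ?thesis using True IH by (simp add: koszul_minus)
    next
      case False
      have "koszul X vs (koszul X (v # vs) c) A
          = koszul X vs ((\<lambda>A. X v (c (insert v A))) + koszul X vs c) A"
        using v False by (intro koszul_cong) auto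
      then show ?thesis using False IH v
        by (simp add: koszul_add koszul_insert X_minus)
    qed
  qed
qed auto

end

locale homotopy_operator = commuting_operators X for X :: "'v \<Rightarrow> 'a::ab_group_add \<Rightarrow> 'a" +
  fixes v :: 'v and L :: "'a \<Rightarrow> 'a"
  assumes L_additive: "additive L"
    and L_commute: "w \<noteq> v \<Longrightarrow> L (X w z) = X w (L z)"
begin

lemmas L_add = additive.add[OF L_additive] and L_minus = additive.minus[OF L_additive]
  and L_zero = additive.zero[OF L_additive]

lemma contraction_cong:
  assumes "w \<notin> set vs" "w \<noteq> v" "\<And>B. w \<in> B \<longleftrightarrow> w \<in> A \<Longrightarrow> c B = c' B"
  shows "contraction v L vs c A = contraction v L vs c' A"
  using assms by (induction vs) auto

lemma contraction_add: "contraction v L vs (c + c') = contraction v L vs c + contraction v L vs c'"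
  by (induction vs) (auto simp: L_add fun_eq_iff)

lemma contraction_zero: "contraction v L vs 0 = 0"
  using contraction_add[of vs 0 0] by simp

lemma contraction_minus: "contraction v L vs (- c) = - contraction v L vs c"
  by (induction vs) (auto simp: L_minus fun_eq_iff)

lemma contraction_insert:
  assumes "w \<notin> set vs" "w \<noteq> v"
  shows "contraction v L vs (\<lambda>A. X w (c (insert w A))) A = X w (contraction v L vs c (insert w A))"
  using assms
  by (induction vs) (auto simp: X_zero X_minus L_commute insert_Diff_if)

lemma koszul_delete:
  assumes "v \<notin> set vs"
  shows "koszul X vs (\<lambda>A. L (c (A - {v}))) A = L (koszul X vs c (A - {v}))"
  using assms
proof (induction vs arbitrary: A)
  case (Cons w vs)
  then show ?case by (auto simp: L_minus L_add L_commute insert_Diff_if)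
qed (simp add: L_zero)

text \<open>
  For variables \<open>w \<noteq> v\<close> the contributions to both summands cancel by the sign rule, because \<open>L\<close> commutes
  with \<open>X w\<close>; only the terms that add and remove \<open>v\<close> itself survive.
\<close>

lemma homotopy:
  assumes "distinct vs" "v \<in> set vs"
  shows "koszul X vs (contraction v L vs c) A + contraction v L vs (koszul X vs c) A
    = (if v \<in> A then L (X v (c A)) else X v (L (c A)))"
  using assms
proof (induction vs arbitrary: A)
  case (Cons w ws)
  show ?case
  proof (cases "w = v")
    case True
    then have v: "v \<notin> set ws" using Cons.prems by simp
    show ?thesis
    proof (cases "v \<in> A")
      case vA: True
      have "koszul X ws (contraction v L (v # ws) c) A = koszul X ws (\<lambda>A. L (c (A - {v}))) A"
        using v vA by (intro koszul_cong) auto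
      then show ?thesis using True vA v
        by (simp add: koszul_delete L_add insert_absorb)
    next
      case vA: False
      have "koszul X ws (contraction v L (v # ws) c) A = koszul X ws 0 A"
        using v vA by (intro koszul_cong) auto
      then show ?thesis using True vA v by (simp add: koszul_zero)
    qed
  next
    case False
    then have w: "w \<notin> set ws" and IH:
      "koszul X ws (contraction v L ws c) A + contraction v L ws (koszul X ws c) A
        = (if v \<in> A then L (X v (c A)) else X v (L (c A)))"
      using Cons by auto
    show ?thesis
    proof (cases "w \<in> A")
      case True
      have "koszul X ws (contraction v L (w # ws) c) A = koszul X ws (- contraction v L ws c) A"
        using w True False by (intro koszul_cong) auto
      moreover have "contraction v L ws (koszul X (w # ws) c) A
          = contraction v L ws (- koszul X ws c) A"
        using w True False by (intro contraction_cong) auto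
      ultimately show ?thesis using True False IH
        by (simp add: koszul_minus contraction_minus)
    next
      case wA: False
      have "koszul X ws (contraction v L (w # ws) c) A = koszul X ws (contraction v L ws c) A"
        using w wA False by (intro koszul_cong) auto
      moreover have "contraction v L ws (koszul X (w # ws) c) A
          = contraction v L ws ((\<lambda>A. X w (c (insert w A))) + koszul X ws c) A"
        using w wA False by (intro contraction_cong) auto
      ultimately show ?thesis using wA w False IH
        by (simp add: contraction_add contraction_insert X_minus)
    qed
  qed
qed simp

end

text \<open>
  For a graded module \<open>N\<close> and a degree \<open>d\<close>, the coefficient at \<open>A\<close> of a Koszul chain of degree \<open>d\<close> lies in the part
  of \<open>N\<close> of degree \<open>d\<close> minus the degree of \<open>A\<close>. A Koszul family \<open>M\<close> records just these parts,
  \<open>M A\<close> standing for the one that belongs to \<open>A\<close>.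
\<close>

definition koszul_family :: "('v \<Rightarrow> 'a \<Rightarrow> 'a) \<Rightarrow> ('v set \<Rightarrow> 'a::ab_group_add set) \<Rightarrow> bool" where
  "koszul_family X M \<longleftrightarrow> (\<forall>A. 0 \<in> M A \<and> (\<forall>y\<in>M A. \<forall>z\<in>M A. y - z \<in> M A)) \<and>
     (\<forall>v A z. v \<notin> A \<longrightarrow> z \<in> M (insert v A) \<longrightarrow> X v z \<in> M A)"

text \<open>
  Exactness in all homological degrees at once, including degree \<open>0\<close>: the coefficient at the empty
  set must also come from a boundary.
\<close>

definition koszul_exact ::
    "('v \<Rightarrow> 'a \<Rightarrow> 'a) \<Rightarrow> 'v list \<Rightarrow> ('v set \<Rightarrow> 'a::ab_group_add set) \<Rightarrow> bool" where
  "koszul_exact X vs M \<longleftrightarrow> (\<forall>c. (\<forall>A. c A \<in> M A) \<longrightarrow> koszul X vs c = 0 \<longrightarrow>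
     (\<exists>u. (\<forall>A. u A \<in> M A) \<and> koszul X vs u = c))"

lemma koszul_family_zero: "koszul_family X M \<Longrightarrow> 0 \<in> M A"
  and koszul_family_diff: "koszul_family X M \<Longrightarrow> y \<in> M A \<Longrightarrow> z \<in> M A \<Longrightarrow> y - z \<in> M A"
  and koszul_family_act: "koszul_family X M \<Longrightarrow> v \<notin> A \<Longrightarrow> z \<in> M (insert v A) \<Longrightarrow> X v z \<in> M A"
  by (auto simp: koszul_family_def)

lemma koszul_family_minus: "koszul_family X M \<Longrightarrow> z \<in> M A \<Longrightarrow> - z \<in> M A"
  using koszul_family_diff[of X M 0 A z] koszul_family_zero[of X M A] by simp

lemma koszul_family_add: "koszul_family X M \<Longrightarrow> y \<in> M A \<Longrightarrow> z \<in> M A \<Longrightarrow> y + z \<in> M A"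
  using koszul_family_diff[of X M y A "- z"] koszul_family_minus[of X M z A] by simp

lemma koszul_in_family:
  assumes "koszul_family X M" "\<And>A. c A \<in> M A"
  shows "koszul X vs c A \<in> M A"
  using assms(2)
proof (induction vs arbitrary: A)
  case (Cons v vs)
  then show ?case
    by (auto intro!: koszul_family_minus[OF assms(1)] koszul_family_add[OF assms(1)]
        koszul_family_act[OF assms(1)])
qed (simp add: koszul_family_zero[OF assms(1)])

lemma contraction_in_family:
  assumes "koszul_family X M" "\<And>A. c A \<in> M A"
    and "\<And>A z. v \<notin> A \<Longrightarrow> z \<in> M A \<Longrightarrow> L z \<in> M (insert v A)"
  shows "contraction v L vs c A \<in> M A"
proof (induction vs)
  case (Cons w ws)
  have "L (c (A - {v})) \<in> M A" if "v \<in> A"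
    using assms(3)[of "A - {v}" "c (A - {v})"] assms(2) that by (simp add: insert_absorb)
  then show ?case using Cons assms(1) by (auto intro: koszul_family_zero koszul_family_minus)
qed (auto intro: assms(1) koszul_family_zero)

lemma koszul_natural:
  assumes "additive \<phi>" "\<And>v z. \<phi> (X v z) = Y v (\<phi> z)"
  shows "koszul Y vs (\<lambda>A. \<phi> (c A)) A = \<phi> (koszul X vs c A)"
  by (induction vs)
     (auto simp: additive.zero[OF assms(1)] additive.minus[OF assms(1)] additive.add[OF assms(1)]
       assms(2))

text \<open>
  The dimension shift that carries the whole proof. It is the part of the long exact sequence of
  \<open>0 \<rightarrow> Z \<rightarrow> F \<rightarrow> M \<rightarrow> 0\<close> that is needed here: if the Koszul complex of \<open>M\<close> is exact and each cycle of \<open>Z\<close> becomes a boundary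
  in \<open>F\<close>, then the Koszul complex of \<open>Z\<close> is exact. A bounding chain \<open>u\<close> in \<open>F\<close> maps to a cycle
  of \<open>M\<close>, hence to the boundary of some \<open>w\<close>; subtracting the boundary of a lift of \<open>w\<close> moves \<open>u\<close> into \<open>Z\<close>.
\<close>

lemma koszul_exact_kernel:
  assumes X: "commuting_operators X" and F: "koszul_family X F" and vs: "distinct vs"
    and \<phi>: "additive \<phi>" "\<And>v z. \<phi> (X v z) = Y v (\<phi> z)"
    and onto: "\<And>A. \<phi> ` F A = M A" and Z: "\<And>A. Z A = {z \<in> F A. \<phi> z = 0}"
    and exact: "koszul_exact Y vs M"
    and bound: "\<And>c. (\<And>A. c A \<in> Z A) \<Longrightarrow> koszul X vs c = 0 \<Longrightarrow>
      \<exists>u. (\<forall>A. u A \<in> F A) \<and> koszul X vs u = c"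
  shows "koszul_exact X vs Z"
  unfolding koszul_exact_def
proof (intro allI impI)
  fix c assume c: "\<forall>A. c A \<in> Z A" "koszul X vs c = 0"
  interpret commuting_operators X by (rule X)
  obtain u where u: "\<And>A. u A \<in> F A" "koszul X vs u = c" using bound[of c] c by auto
  have "koszul Y vs (\<lambda>A. \<phi> (u A)) = 0"
    using c(1) koszul_natural[of \<phi> X Y vs u, OF \<phi>] u(2) Z by (auto simp: fun_eq_iff)
  moreover have "\<forall>A. \<phi> (u A) \<in> M A" using u onto by blast
  ultimately obtain w where w: "\<And>A. w A \<in> M A" "koszul Y vs w = (\<lambda>A. \<phi> (u A))"
    using exact[unfolded koszul_exact_def, rule_format, of "\<lambda>A. \<phi> (u A)"] by metis
  have "\<forall>A. \<exists>z\<in>F A. \<phi> z = w A" using w(1) onto by (metis imageE)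
  then obtain w' where w': "\<And>A. w' A \<in> F A" "\<And>A. \<phi> (w' A) = w A" by metis
  let ?u = "u - koszul X vs w'"
  have "\<phi> (?u A) = 0" for A
    using koszul_natural[of \<phi> X Y vs w', OF \<phi>] w w'
    by (simp add: additive.diff[OF \<phi>(1)])
  moreover have "?u A \<in> F A" for A
    using F u w' by (auto intro: koszul_family_diff koszul_in_family)
  moreover have "koszul X vs ?u = c" using u vs by (simp add: koszul_diff koszul_koszul)
  ultimately show "\<exists>u. (\<forall>A. u A \<in> Z A) \<and> koszul X vs u = c" using Z by blast
qed

lemma koszul_exact_iso:
  assumes \<phi>: "additive \<phi>" "\<And>v z. \<phi> (X v z) = Y v (\<phi> z)" "\<And>z. \<phi> z = 0 \<Longrightarrow> z = 0"
    and onto: "\<And>A. \<phi> ` N A = M A" and exact: "koszul_exact Y vs M"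
  shows "koszul_exact X vs N"
  unfolding koszul_exact_def
proof (intro allI impI)
  fix c assume c: "\<forall>A. c A \<in> N A" "koszul X vs c = 0"
  have "koszul Y vs (\<lambda>A. \<phi> (c A)) = 0"
    using koszul_natural[of \<phi> X Y vs c, OF \<phi>(1,2)] c additive.zero[OF \<phi>(1)]
    by (auto simp: fun_eq_iff)
  moreover have "\<forall>A. \<phi> (c A) \<in> M A" using c onto by blast
  ultimately obtain w where w: "\<And>A. w A \<in> M A" "koszul Y vs w = (\<lambda>A. \<phi> (c A))"
    using exact[unfolded koszul_exact_def, rule_format, of "\<lambda>A. \<phi> (c A)"] by metis
  have "\<forall>A. \<exists>z\<in>N A. \<phi> z = w A" using w(1) onto by (metis imageE)
  then obtain u where u: "\<And>A. u A \<in> N A" "\<And>A. \<phi> (u A) = w A" by metis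
  have "\<phi> (koszul X vs u A - c A) = 0" for A
    using koszul_natural[of \<phi> X Y vs u, OF \<phi>(1,2)] w u
    by (simp add: additive.diff[OF \<phi>(1)])
  then have "koszul X vs u = c" using \<phi>(3) by (metis eq_iff_diff_eq_0 ext)
  then show "\<exists>u. (\<forall>A. u A \<in> N A) \<and> koszul X vs u = c" using u by blast
qed

lemma koszul_product_apply:
  "koszul (\<lambda>v f i. X i v (f i)) vs c A i = koszul (X i) vs (\<lambda>B. c B i) A"
  by (induction vs) auto

text \<open>
  Used for the direct sums of localizations in the Cech complex and for free modules; the operators
  act on each coordinate separately.
\<close>

lemma koszul_exact_product:
  assumes "\<And>i. koszul_exact (X i) vs (M i)"
  shows "koszul_exact (\<lambda>v f i. X i v (f i)) vs (\<lambda>A. {f. \<forall>i. f i \<in> M i A})"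
  unfolding koszul_exact_def
proof (intro allI impI)
  fix c assume c: "\<forall>A. c A \<in> {f. \<forall>i. f i \<in> M i A}"
    "koszul (\<lambda>v f i. X i v (f i)) vs c = 0"
  have "\<exists>u. (\<forall>A. u A \<in> M i A) \<and> koszul (X i) vs u = (\<lambda>B. c B i)" for i
  proof -
    have "koszul (X i) vs (\<lambda>B. c B i) A = 0" for A
      using c(2) koszul_product_apply[of X vs c A i] by simp
    then show ?thesis using assms[of i] c(1) by (auto simp: koszul_exact_def fun_eq_iff)
  qed
  then obtain u where u: "\<And>i A. u i A \<in> M i A" "\<And>i. koszul (X i) vs (u i) = (\<lambda>B. c B i)"
    by metis
  have "koszul (\<lambda>v f i. X i v (f i)) vs (\<lambda>A i. u i A) = c"
    by (intro ext) (simp add: koszul_product_apply u(2))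
  then show "\<exists>u. (\<forall>A. u A \<in> {f. \<forall>i. f i \<in> M i A}) \<and> koszul (\<lambda>v f i. X i v (f i)) vs u = c"
    using u(1) by (intro exI[of _ "\<lambda>A i. u i A"]) auto
qed

lemma commuting_operators_times: "commuting_operators (\<lambda>v f i. x v * (f i :: 'a::comm_ring_1))"
  by (standard; intro ext) (auto simp: algebra_simps)

lemma commuting_operators_ring: "commuting_operators (\<lambda>v. (*) (x v :: 'a::comm_ring_1))"
  by standard (auto simp: algebra_simps)

lemma koszul_exact_zero: "koszul_exact X vs (\<lambda>A. {0})"
  if "commuting_operators X"
proof -
  interpret commuting_operators X by fact
  show ?thesis unfolding koszul_exact_def
    by (intro allI impI exI[of _ 0]) (auto simp: koszul_zero fun_eq_iff)
qed

lemma koszul_family_product: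
  assumes "\<And>i. koszul_family (X i) (M i)"
  shows "koszul_family (\<lambda>v f i. X i v (f i)) (\<lambda>A. {f. \<forall>i. f i \<in> M i A})"
  using assms unfolding koszul_family_def by auto

text \<open>
  If \<open>X v\<close> has an inverse that respects the family, the homotopy formula makes every cycle the boundary of
  its contraction.
\<close>

lemma koszul_exact_invertible:
  assumes "homotopy_operator X v L" "koszul_family X M" "distinct vs" "v \<in> set vs"
    and inv: "\<And>z. L (X v z) = z" "\<And>z. X v (L z) = z"
    and L: "\<And>A z. v \<notin> A \<Longrightarrow> z \<in> M A \<Longrightarrow> L z \<in> M (insert v A)"
  shows "koszul_exact X vs M"
  unfolding koszul_exact_def
proof (intro allI impI)
  fix c assume c: "\<forall>A. c A \<in> M A" "koszul X vs c = 0"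
  interpret homotopy_operator X v L by fact
  have "koszul X vs (contraction v L vs c) = c"
    using homotopy[OF assms(3,4), of c] c(2) inv contraction_zero by (auto simp: fun_eq_iff)
  moreover have "\<forall>A. contraction v L vs c A \<in> M A"
    using c(1) L assms(2) by (auto intro: contraction_in_family)
  ultimately show "\<exists>u. (\<forall>A. u A \<in> M A) \<and> koszul X vs u = c" by blast
qed

section \<open>Monomials, Laurent polynomials and bidegrees\<close>

lemma lookup_single_times:
  fixes f :: "'e::cancel_comm_monoid_add \<Rightarrow>\<^sub>0 'k::semiring_1"
  shows "Poly_Mapping.lookup (Poly_Mapping.single t 1 * f) (t + e) = Poly_Mapping.lookup f e"
  by (simp add: lookup_mult lookup_single when_mult)

lemma keys_single_times:
  fixes f :: "'e::cancel_comm_monoid_add \<Rightarrow>\<^sub>0 'k::semiring_1"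
  shows "Poly_Mapping.keys (Poly_Mapping.single t 1 * f) = (+) t ` Poly_Mapping.keys f"
proof
  show "Poly_Mapping.keys (Poly_Mapping.single t 1 * f) \<subseteq> (+) t ` Poly_Mapping.keys f"
    using keys_mult[of "Poly_Mapping.single t 1" f] by (auto split: if_splits)
qed (auto simp: in_keys_iff lookup_single_times)

lemma lookup_map_int [simp]: "Poly_Mapping.lookup (Poly_Mapping.map int e) v = int (Poly_Mapping.lookup e v)"
  by (simp add: Poly_Mapping.map.rep_eq when_def)

lemma map_int_add: "Poly_Mapping.map int (e + e') = Poly_Mapping.map int e + Poly_Mapping.map int e'"
  by (rule poly_mapping_eqI) (simp add: lookup_add)

lemma map_int_0: "Poly_Mapping.map int 0 = 0"
  by (rule poly_mapping_eqI) simp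

lemma map_int_sum: "Poly_Mapping.map int (sum e A) = (\<Sum>i\<in>A. Poly_Mapping.map int (e i))"
  by (rule poly_mapping_eqI) (simp add: lookup_sum)

lemma map_int_eq_iff: "Poly_Mapping.map int e = Poly_Mapping.map int e' \<longleftrightarrow> e = e'"
  by (auto simp: poly_mapping_eq_iff fun_eq_iff)

lemma lookup_to_laurent:
  "Poly_Mapping.lookup (to_laurent f) (Poly_Mapping.map int e) = Poly_Mapping.lookup f e"
proof -
  have "Poly_Mapping.lookup (to_laurent f) (Poly_Mapping.map int e)
      = (\<Sum>e'\<in>Poly_Mapping.keys f. if e' = e then Poly_Mapping.lookup f e' else 0)"
    by (auto simp: to_laurent_def lookup_sum lookup_single map_int_eq_iff when_def intro: sum.cong)
  then show ?thesis by (simp add: in_keys_iff)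
qed

lemma keys_to_laurent: "Poly_Mapping.keys (to_laurent f) = Poly_Mapping.map int ` Poly_Mapping.keys f"
proof
  show "Poly_Mapping.keys (to_laurent f) \<subseteq> Poly_Mapping.map int ` Poly_Mapping.keys f"
    using keys_sum[of "\<lambda>e. Poly_Mapping.single (Poly_Mapping.map int e) (Poly_Mapping.lookup f e)" "Poly_Mapping.keys f"]
    by (auto simp: to_laurent_def split: if_splits)
qed (auto simp: in_keys_iff lookup_to_laurent)

lemma laurent_eqI:
  assumes "Poly_Mapping.keys g \<subseteq> Poly_Mapping.map int ` UNIV" "Poly_Mapping.keys h \<subseteq> Poly_Mapping.map int ` UNIV"
    and "\<And>e. Poly_Mapping.lookup g (Poly_Mapping.map int e) = Poly_Mapping.lookup h (Poly_Mapping.map int e)"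
  shows "g = h"
proof (rule poly_mapping_eqI)
  fix k
  show "Poly_Mapping.lookup g k = Poly_Mapping.lookup h k"
  proof (cases "k \<in> Poly_Mapping.map int ` UNIV")
    case False
    then have "k \<notin> Poly_Mapping.keys g" "k \<notin> Poly_Mapping.keys h" using assms by blast+
    then show ?thesis by (simp add: in_keys_iff)
  qed (use assms(3) in auto)
qed

lemma to_laurent_add: "to_laurent (f + g) = to_laurent f + to_laurent g"
proof (rule laurent_eqI)
  show "Poly_Mapping.keys (to_laurent f + to_laurent g) \<subseteq> Poly_Mapping.map int ` UNIV"
    using keys_add[of "to_laurent f" "to_laurent g"] by (auto simp: keys_to_laurent)
qed (auto simp: keys_to_laurent lookup_add lookup_to_laurent)

lemma additive_to_laurent: "additive to_laurent"
  by (rule additive.intro) (rule to_laurent_add)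

lemma to_laurent_eq_0: "to_laurent f = 0 \<longleftrightarrow> f = 0"
  by (metis keys_eq_empty keys_to_laurent image_is_empty)

lemma to_laurent_monomial:
  "to_laurent (Poly_Mapping.single t 1 * f)
    = Poly_Mapping.single (Poly_Mapping.map int t) 1 * to_laurent f" (is "_ = ?r")
proof (rule laurent_eqI)
  have keys_r: "Poly_Mapping.keys ?r = Poly_Mapping.map int ` (+) t ` Poly_Mapping.keys f"
    by (simp add: keys_single_times keys_to_laurent image_image map_int_add)
  show "Poly_Mapping.keys ?r \<subseteq> Poly_Mapping.map int ` UNIV" by (auto simp: keys_r)
  fix e
  show "Poly_Mapping.lookup (to_laurent (Poly_Mapping.single t 1 * f)) (Poly_Mapping.map int e)
      = Poly_Mapping.lookup ?r (Poly_Mapping.map int e)"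
  proof (cases "e \<in> (+) t ` UNIV")
    case True
    then show ?thesis by (auto simp: lookup_to_laurent lookup_single_times map_int_add)
  next
    case False
    then have "e \<notin> Poly_Mapping.keys (Poly_Mapping.single t 1 * f)"
      by (auto simp: keys_single_times)
    moreover have "Poly_Mapping.map int e \<notin> Poly_Mapping.keys ?r"
      unfolding keys_r using False by (auto simp: map_int_eq_iff)
    ultimately show ?thesis by (simp add: lookup_to_laurent in_keys_iff)
  qed
qed (auto simp: keys_to_laurent)

definition var_degree :: "'x + 'y \<Rightarrow> int \<times> int" where
  "var_degree v = (case v of Inl _ \<Rightarrow> (1, 0) | Inr _ \<Rightarrow> (0, 1))"

text \<open>
  The degree of the coefficient at \<open>A\<close> in a Koszul chain of degree \<open>d\<close>.
\<close>

definition strand :: "int \<times> int \<Rightarrow> ('x + 'y) set \<Rightarrow> int \<times> int" where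
  "strand d A = d - (\<Sum>v\<in>A. var_degree v)"

abbreviation variable :: "'v \<Rightarrow> ('v \<Rightarrow>\<^sub>0 'n::{zero,one}) \<Rightarrow>\<^sub>0 'k::{zero,one}" where
  "variable v \<equiv> Poly_Mapping.single (Poly_Mapping.single v 1) 1"

lemma strand_insert:
  fixes A :: "('x::finite + 'y::finite) set"
  shows "v \<notin> A \<Longrightarrow> strand d A = var_degree v + strand d (insert v A)"
  by (simp add: strand_def)

lemma strand_diff: "strand (d - r) A = strand d A - r"
  by (simp add: strand_def)

text \<open>
  With \<open>n + 1\<close> variables \<open>x\<^sub>i\<close> and \<open>m + 1\<close> variables \<open>y\<^sub>j\<close>, this is the reason why the degree
  \<open>(a + n + 1, b + m + 1)\<close> is special: a set of variables has degree at
  most \<open>(n + 1, m + 1)\<close>, so all coefficients of Koszul chains of this degree lie in degrees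
  \<open>\<ge> (a, b)\<close>, where the hypothesis of the theorem makes the local cohomology vanish.
\<close>

lemma strand_ge:
  fixes A :: "('x::finite + 'y::finite) set"
  shows "a \<le> fst (strand (a + int CARD('x), b + int CARD('y)) A)"
    and "b \<le> snd (strand (a + int CARD('x), b + int CARD('y)) A)"
proof -
  have nonneg: "0 \<le> fst (var_degree v)" "0 \<le> snd (var_degree v)" for v :: "'x + 'y"
    by (simp_all add: var_degree_def split: sum.split)
  have "fst (\<Sum>v\<in>A. var_degree v) \<le> fst (\<Sum>v\<in>(UNIV :: ('x + 'y) set). var_degree v)"
    and "snd (\<Sum>v\<in>A. var_degree v) \<le> snd (\<Sum>v\<in>(UNIV :: ('x + 'y) set). var_degree v)"
    unfolding fst_sum snd_sum using nonneg by (auto intro!: sum_mono2)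
  moreover have "(\<Sum>v\<in>(UNIV :: ('x + 'y) set). var_degree v) = (int CARD('x), int CARD('y))"
    by (simp add: UNIV_Plus_UNIV[symmetric] sum.Plus var_degree_def sum_prod
        del: UNIV_Plus_UNIV)
  ultimately show "a \<le> fst (strand (a + int CARD('x), b + int CARD('y)) A)"
    "b \<le> snd (strand (a + int CARD('x), b + int CARD('y)) A)"
    by (simp_all add: strand_def)
qed

lemma bideg_add: "bideg (e + e') = bideg e + bideg e'"
  by (simp add: bideg_def lookup_add sum.distrib)

lemma bideg_0 [simp]: "bideg 0 = 0"
  by (simp add: bideg_def zero_prod_def)

lemma bideg_minus: "bideg (- e) = - bideg e"
  using bideg_add[of e "- e"] by (simp add: eq_neg_iff_add_eq_0 add.commute)

lemma bideg_single: "bideg (Poly_Mapping.single v 1) = var_degree v"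
  by (cases v) (auto simp: bideg_def var_degree_def lookup_single when_def)

lemma laurent_bihomogeneous_to_laurent:
  "laurent_bihomogeneous d (to_laurent f) \<longleftrightarrow> bihomogeneous d f"
  by (auto simp: laurent_bihomogeneous_def bihomogeneous_def keys_to_laurent)

lemma laurent_bihomogeneous_0 [simp]: "laurent_bihomogeneous d 0"
  by (simp add: laurent_bihomogeneous_def)

lemma laurent_bihomogeneous_diff:
  fixes f g :: "('x::finite, 'y::finite, 'k::ab_group_add) bilaurent"
  shows "laurent_bihomogeneous d f \<Longrightarrow> laurent_bihomogeneous d g
  \<Longrightarrow> laurent_bihomogeneous d (f - g)"
  by (auto simp: laurent_bihomogeneous_def in_keys_iff lookup_minus)

lemma laurent_bihomogeneous_monomial:
  fixes f :: "('x::finite, 'y::finite, 'k::comm_ring_1) bilaurent"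
  shows "laurent_bihomogeneous d f \<Longrightarrow> d' = bideg t + d
  \<Longrightarrow> laurent_bihomogeneous d' (Poly_Mapping.single t 1 * f)"
  by (auto simp: laurent_bihomogeneous_def keys_single_times bideg_add)

lemma module_times: "Modules.module ((*) :: 'a::comm_ring_1 \<Rightarrow> 'a \<Rightarrow> 'a)"
  by unfold_locales (auto simp: algebra_simps)

lemma ideal_span_ideal:
  fixes G :: "'a::comm_ring_1 set"
  shows "0 \<in> ideal_span G" "f \<in> ideal_span G \<Longrightarrow> g \<in> ideal_span G \<Longrightarrow> f - g \<in> ideal_span G"
    "f \<in> ideal_span G \<Longrightarrow> h * f \<in> ideal_span G"
  using Modules.module.span_zero[OF module_times] Modules.module.span_diff[OF module_times]
    Modules.module.span_scale[OF module_times] by blast+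

section \<open>Localizations at products of the x-variables\<close>

locale is_ideal =
  fixes I :: "'a::comm_ring_1 set"
  assumes ideal_0: "0 \<in> I"
    and ideal_diff: "f \<in> I \<Longrightarrow> g \<in> I \<Longrightarrow> f - g \<in> I"
    and ideal_mult: "f \<in> I \<Longrightarrow> h * f \<in> I"

text \<open>
  The condition on \<open>e\<close> says that multiplication by the monomial with exponent \<open>e\<close> turns each denominator
  into another one times a monomial of the polynomial ring. It covers the variables and the inverses of
  the variables that are already inverted.
\<close>

lemma x_localization_monomial:
  fixes I :: "('x::finite, 'y::finite, 'k::field) bipoly set"
  assumes "is_ideal I" "g \<in> x_localization I A"
    and e: "\<And>t. \<exists>t' e'. e + (\<Sum>i\<in>A. Poly_Mapping.single (Inl i) (- int t))
      = (\<Sum>i\<in>A. Poly_Mapping.single (Inl i) (- int t')) + Poly_Mapping.map int e'"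
  shows "Poly_Mapping.single e 1 * g \<in> x_localization I A"
proof -
  obtain f t where g: "f \<in> I"
    "g = Poly_Mapping.single (\<Sum>i\<in>A. Poly_Mapping.single (Inl i) (- int t)) 1 * to_laurent f"
    using assms(2) by (auto simp: x_localization_def)
  obtain t' e' where e': "e + (\<Sum>i\<in>A. Poly_Mapping.single (Inl i) (- int t))
      = (\<Sum>i\<in>A. Poly_Mapping.single (Inl i) (- int t')) + Poly_Mapping.map int e'"
    using e by blast
  have "Poly_Mapping.single e 1 * g
      = Poly_Mapping.single (\<Sum>i\<in>A. Poly_Mapping.single (Inl i) (- int t')) 1 *
        to_laurent (Poly_Mapping.single e' 1 * f)"
    by (simp add: g to_laurent_monomial mult.assoc[symmetric] mult_single e')
  moreover have "Poly_Mapping.single e' 1 * f \<in> I"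
    using assms(1) g(1) by (auto simp: is_ideal_def)
  ultimately show ?thesis by (auto simp: x_localization_def)
qed

lemma x_localization_variable:
  fixes I :: "('x::finite, 'y::finite, 'k::field) bipoly set"
  assumes "is_ideal I" "g \<in> x_localization I A"
  shows "variable v * g \<in> x_localization I A"
proof (rule x_localization_monomial[OF assms])
  fix t
  show "\<exists>t' e'. Poly_Mapping.single v 1 + (\<Sum>i\<in>A. Poly_Mapping.single (Inl i) (- int t))
      = (\<Sum>i\<in>A. Poly_Mapping.single (Inl i) (- int t')) + Poly_Mapping.map int e'"
    by (intro exI[of _ t] exI[of _ "Poly_Mapping.single v 1"]) (simp add: add.commute)
qed

lemma x_localization_inverse_variable:
  fixes I :: "('x::finite, 'y::finite, 'k::field) bipoly set"
  assumes "is_ideal I" "g \<in> x_localization I A" "i \<in> A"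
  shows "Poly_Mapping.single (- Poly_Mapping.single (Inl i) 1) 1 * g \<in> x_localization I A"
proof (rule x_localization_monomial[OF assms(1,2)])
  fix t
  have "- Poly_Mapping.single (Inl i :: 'x + 'y) 1 + (\<Sum>j\<in>A. Poly_Mapping.single (Inl j) (- int t))
      = (\<Sum>j\<in>A. Poly_Mapping.single (Inl j) (- int (Suc t)))
        + Poly_Mapping.map int (\<Sum>j\<in>A - {i}. Poly_Mapping.single (Inl j) 1)"
    (is "?l = ?r")
  proof -
    have "(\<Sum>j\<in>A. Poly_Mapping.single (Inl j :: 'x + 'y) (- int (Suc t)))
        = (\<Sum>j\<in>A. Poly_Mapping.single (Inl j) (- int t)) - (\<Sum>j\<in>A. Poly_Mapping.single (Inl j) 1)"
      by (simp add: sum_subtractf[symmetric] single_diff[symmetric] minus_diff_commute)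
    moreover have "Poly_Mapping.map int (\<Sum>j\<in>A - {i}. Poly_Mapping.single (Inl j :: 'x + 'y) 1)
        = (\<Sum>j\<in>A. Poly_Mapping.single (Inl j) 1) - Poly_Mapping.single (Inl i) 1"
      using assms(3) by (simp add: map_int_sum sum_diff1)
    ultimately show ?thesis by simp
  qed
  then show "\<exists>t' e'. ?l = (\<Sum>j\<in>A. Poly_Mapping.single (Inl j) (- int t')) + Poly_Mapping.map int e'"
    by blast
qed

lemma x_localization_common_denominator:
  fixes I :: "('x::finite, 'y::finite, 'k::field) bipoly set"
  assumes "is_ideal I" "f \<in> I"
  obtains f' where "f' \<in> I"
    "Poly_Mapping.single (\<Sum>i\<in>A. Poly_Mapping.single (Inl i) (- int t)) 1 * to_laurent f
      = Poly_Mapping.single (\<Sum>i\<in>A. Poly_Mapping.single (Inl i) (- int (t + s))) 1 * to_laurent f'"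
proof -
  \<comment> \<open>Numerator and denominator are multiplied by the \<open>s\<close>-th power of the product of the \<open>x\<^sub>i\<close>.\<close>
  let ?m = "\<Sum>i\<in>A. Poly_Mapping.single (Inl i) s"
  have "(\<Sum>i\<in>A. Poly_Mapping.single (Inl i) (- int (t + s))) + Poly_Mapping.map int ?m
      = (\<Sum>i\<in>A. Poly_Mapping.single (Inl i :: 'x + 'y) (- int t))"
    by (simp add: map_int_sum sum.distrib[symmetric] single_add[symmetric])
  then show ?thesis using assms
    by (intro that[of "Poly_Mapping.single ?m 1 * f"])
       (auto simp: is_ideal_def to_laurent_monomial mult.assoc[symmetric] mult_single)
qed

lemma x_localization_diff:
  fixes I :: "('x::finite, 'y::finite, 'k::field) bipoly set"
  assumes I: "is_ideal I" and g: "g \<in> x_localization I A" and h: "h \<in> x_localization I A"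
  shows "g - h \<in> x_localization I A"
proof -
  obtain f t where f: "f \<in> I"
    "g = Poly_Mapping.single (\<Sum>i\<in>A. Poly_Mapping.single (Inl i) (- int t)) 1 * to_laurent f"
    using g by (auto simp: x_localization_def)
  obtain f' s where f': "f' \<in> I"
    "h = Poly_Mapping.single (\<Sum>i\<in>A. Poly_Mapping.single (Inl i) (- int s)) 1 * to_laurent f'"
    using h by (auto simp: x_localization_def)
  obtain k where k: "k \<in> I" "g = Poly_Mapping.single
      (\<Sum>i\<in>A. Poly_Mapping.single (Inl i) (- int (t + s))) 1 * to_laurent k"
    using x_localization_common_denominator[OF I f(1)] f(2) by metis
  obtain k' where k': "k' \<in> I" "h = Poly_Mapping.single
      (\<Sum>i\<in>A. Poly_Mapping.single (Inl i) (- int (t + s))) 1 * to_laurent k'"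
    using x_localization_common_denominator[OF I f'(1)] f'(2) by (metis add.commute)
  have "g - h = Poly_Mapping.single (\<Sum>i\<in>A. Poly_Mapping.single (Inl i) (- int (t + s))) 1
      * to_laurent (k - k')"
    by (simp add: k k' additive.diff[OF additive_to_laurent] right_diff_distrib)
  moreover have "k - k' \<in> I" using k k' I by (auto simp: is_ideal_def)
  ultimately show ?thesis unfolding x_localization_def by blast
qed

lemma x_localization_0:
  fixes I :: "('x::finite, 'y::finite, 'k::field) bipoly set"
  assumes "is_ideal I" shows "0 \<in> x_localization I A"
proof -
  have "0 = Poly_Mapping.single (\<Sum>i\<in>A. Poly_Mapping.single (Inl i :: 'x + 'y) (- int 0)) 1
      * (to_laurent 0 :: ('x, 'y, 'k) bilaurent)"
    by (simp add: additive.zero[OF additive_to_laurent])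
  then show ?thesis using assms unfolding x_localization_def is_ideal_def by blast
qed

section \<open>The Cech complex and the Koszul complex of the ideal\<close>

definition localized_strand ::
    "('x::finite, 'y::finite, 'k::field) bipoly set \<Rightarrow> int \<times> int \<Rightarrow> 'x set
     \<Rightarrow> ('x + 'y) set \<Rightarrow> ('x, 'y, 'k) bilaurent set" where
  "localized_strand I d B A = {g \<in> x_localization I B. laurent_bihomogeneous (strand d A) g}"

lemma koszul_family_localized_strand:
  fixes I :: "('x::finite, 'y::finite, 'k::field) bipoly set"
  assumes "is_ideal I"
  shows "koszul_family (\<lambda>v. (*) (variable v)) (localized_strand I d B)"
proof -
  have "laurent_bihomogeneous (strand d A) (variable v * g)"
    if "v \<notin> A" "laurent_bihomogeneous (strand d (insert v A)) g"
    for v A and g :: "('x, 'y, 'k) bilaurent"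
    using that by (intro laurent_bihomogeneous_monomial[of "strand d (insert v A)"])
      (auto simp: bideg_single strand_insert[of v A d])
  then show ?thesis
    unfolding koszul_family_def localized_strand_def
    by (auto intro: x_localization_0 x_localization_diff x_localization_variable
        laurent_bihomogeneous_diff assms)
qed

text \<open>
  Some \<open>x\<^sub>i\<close> with \<open>i \<in> B\<close> acts invertibly on the localization.
\<close>

lemma koszul_exact_localized_strand:
  fixes I :: "('x::finite, 'y::finite, 'k::field) bipoly set"
  assumes "is_ideal I" "B \<noteq> {}" "distinct vs" "set vs = UNIV"
  shows "koszul_exact (\<lambda>v. (*) (variable v)) vs (localized_strand I d B)"
proof -
  obtain i where i: "i \<in> B" using assms(2) by blast
  let ?L = "\<lambda>g. Poly_Mapping.single (- Poly_Mapping.single (Inl i) 1) 1 * g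
    :: ('x, 'y, 'k) bilaurent"
  show ?thesis
  proof (rule koszul_exact_invertible[where v = "Inl i" and L = ?L])
    show "homotopy_operator (\<lambda>v. (*) (variable v)) (Inl i) ?L"
      by (intro homotopy_operator.intro commuting_operators_ring homotopy_operator_axioms.intro
          additive.intro) (simp_all add: algebra_simps)
    show "?L z \<in> localized_strand I d B (insert (Inl i) A)"
      if "Inl i \<notin> A" "z \<in> localized_strand I d B A" for A z
    proof -
      have "laurent_bihomogeneous (strand d (insert (Inl i) A)) (?L z)"
        using that by (intro laurent_bihomogeneous_monomial[of "strand d A"])
          (auto simp: localized_strand_def bideg_minus bideg_single strand_insert[of "Inl i" A d])
      then show ?thesis
        using that i assms(1) by (simp add: localized_strand_def x_localization_inverse_variable)
    qed
    show "?L (variable (Inl i) * z) = z" "variable (Inl i) * ?L z = z" for z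
      by (simp_all add: mult.assoc[symmetric] mult_single)
  qed (use assms in \<open>auto intro: koszul_family_localized_strand[OF assms(1)]\<close>)
qed

lemma cech_cochains_eq_product:
  "cech_cochains I p (strand d A)
    = {c. \<forall>B. c B \<in> (if card B = p then localized_strand I d B A else {0})}"
  by (auto simp: cech_cochains_def localized_strand_def split: if_splits)

lemma koszul_family_cech_cochains:
  fixes I :: "('x::finite, 'y::finite, 'k::field) bipoly set"
  assumes "is_ideal I"
  shows "koszul_family (\<lambda>v f B. variable v * f B) (\<lambda>A. cech_cochains I p (strand d A))"
proof -
  have "koszul_family (\<lambda>v. (*) (variable v))
      (\<lambda>A. if card B = p then localized_strand I d B A else {0})" for B
    using koszul_family_localized_strand[OF assms, of d B]
    by (cases "card B = p") (auto simp: koszul_family_def)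
  then show ?thesis
    unfolding cech_cochains_eq_product by (intro koszul_family_product)
qed

lemma koszul_exact_cech_cochains:
  fixes I :: "('x::finite, 'y::finite, 'k::field) bipoly set"
  assumes "is_ideal I" "p \<ge> 1" "distinct vs" "set vs = UNIV"
  shows "koszul_exact (\<lambda>v f B. variable v * f B) vs (\<lambda>A. cech_cochains I p (strand d A))"
proof -
  have "koszul_exact (\<lambda>v. (*) (variable v)) vs
      (\<lambda>A. if card B = p then localized_strand I d B A else {0})" for B
    using koszul_exact_localized_strand[OF assms(1) _ assms(3,4), of B d] assms(2)
      koszul_exact_zero[OF commuting_operators_ring, of variable vs]
    by (cases "card B = p"; cases "B = {}") auto
  then show ?thesis
    unfolding cech_cochains_eq_product by (intro koszul_exact_product)
qed

lemma additive_cech_diff: "additive cech_diff"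
  by (rule additive.intro) (auto simp: cech_diff_def fun_eq_iff distrib_left sum.distrib)

lemma cech_diff_times: "cech_diff (\<lambda>B. h * c B) = (\<lambda>B. h * cech_diff c B)"
  by (rule ext) (simp add: cech_diff_def sum_distrib_left mult.left_commute)

lemma quotient_eq_singleton:
  assumes q: "Z // {(u, v). u \<in> Z \<and> v \<in> Z \<and> R u v} = {B}" and R: "\<And>u. R u u"
  shows "Z = B"
proof
  have "B \<in> Z // {(u, v). u \<in> Z \<and> v \<in> Z \<and> R u v}" by (simp add: q)
  then show "B \<subseteq> Z" by (auto elim!: quotientE)
  show "Z \<subseteq> B"
  proof
    fix u assume u: "u \<in> Z"
    then have "{(u, v). u \<in> Z \<and> v \<in> Z \<and> R u v} `` {u} = B"
      using q by (metis (no_types, lifting) quotientI singletonD)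
    then show "u \<in> B" using u R[of u] by blast
  qed
qed

text \<open>
  The one class in the cohomology is the set of coboundaries, and the classes cover the cocycles.
\<close>

lemma vanishing_cohomology:
  fixes I :: "('x::{finite,linorder}, 'y::finite, 'k::field) bipoly set"
  assumes "is_ideal I" "x_local_cohomology I (Suc p) d = {cech_coboundaries I (Suc p) d}"
  shows "cech_cocycles I (Suc p) d = cech_diff ` cech_cochains I p d"
proof -
  have "0 \<in> cech_cochains I p d"
    using x_localization_0[OF assms(1)] by (simp add: cech_cochains_def)
  then have "cech_diff 0 \<in> cech_coboundaries I (Suc p) d"
    by (simp add: cech_coboundaries_def)
  then have 0: "(\<lambda>A. u A - u A) \<in> cech_coboundaries I (Suc p) d"
    for u :: "'x set \<Rightarrow> ('x, 'y, 'k) bilaurent"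
    by (simp add: additive.zero[OF additive_cech_diff] zero_fun_def[symmetric])
  have "cech_cocycles I (Suc p) d = cech_coboundaries I (Suc p) d"
    by (rule quotient_eq_singleton[OF assms(2)[unfolded x_local_cohomology_def] 0])
  then show ?thesis by (simp add: cech_coboundaries_def)
qed

text \<open>
  Write \<open>C\<^sup>p\<close> and \<open>Z\<^sup>p\<close> for the cochains and cocycles. In the degrees that occur, \<open>0 \<rightarrow> Z\<^sup>p \<rightarrow> C\<^sup>p \<rightarrow> Z\<^sup>p\<^sup>+\<^sup>1 \<rightarrow> 0\<close>
  is exact, and for \<open>p \<ge> 1\<close> the Koszul complex of \<open>C\<^sup>p\<close> is exact. So exactness descends from \<open>Z\<^sup>p\<^sup>+\<^sup>1\<close>
  to \<open>Z\<^sup>p\<close>, beginning with the groups that vanish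
  because no set of \<open>x\<^sub>i\<close> has that many elements.
\<close>

lemma koszul_exact_cech_cocycles:
  fixes I :: "('x::{finite,linorder}, 'y::finite, 'k::field) bipoly set"
  assumes I: "is_ideal I" and vs: "distinct vs" "set vs = UNIV"
    and van: "\<And>p (A :: ('x + 'y) set). cech_cocycles I (Suc p) (strand d A) = cech_diff ` cech_cochains I p (strand d A)"
    and p: "p \<ge> 1"
  shows "koszul_exact (\<lambda>v f B. variable v * f B) vs (\<lambda>A. cech_cocycles I p (strand d A))"
  using p
proof (induction "CARD('x) - p" arbitrary: p rule: less_induct)
  case less
  let ?X = "\<lambda>v f B. variable v * f B :: ('x, 'y, 'k) bilaurent"
  have ops: "commuting_operators ?X" by (rule commuting_operators_times)
  show ?case
  proof (cases "p \<le> CARD('x)")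
    case True
    show ?thesis
    proof (rule koszul_exact_kernel[OF ops koszul_family_cech_cochains[OF I] vs(1) additive_cech_diff])
      show "cech_diff ` cech_cochains I p (strand d A) = cech_cocycles I (Suc p) (strand d A)" for A :: "('x + 'y) set"
        by (rule van[symmetric])
      have "koszul_exact ?X vs (\<lambda>A. cech_cocycles I (Suc p) (strand d A))"
      proof (cases "p = CARD('x)")
        case False
        then show ?thesis using less True by simp
      next
        case True
        have "card B \<noteq> Suc p" for B :: "'x set"
          using card_mono[of UNIV B] True by auto
        then have "cech_cocycles I (Suc p) (strand d A) = {0}" for A :: "('x + 'y) set"
          using additive.zero[OF additive_cech_diff]
          by (auto simp: cech_cocycles_def cech_cochains_def fun_eq_iff)
        then show ?thesis by (simp add: koszul_exact_zero[OF ops])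
      qed
      then show "koszul_exact ?X vs (\<lambda>A. cech_cocycles I (Suc p) (strand d A))" .
      fix c assume "\<And>A. c A \<in> cech_cocycles I p (strand d A)" "koszul ?X vs c = 0"
      then show "\<exists>u. (\<forall>A. u A \<in> cech_cochains I p (strand d A)) \<and> koszul ?X vs u = c"
        using koszul_exact_cech_cochains[OF I less.prems vs, of d]
        by (auto simp: koszul_exact_def cech_cocycles_def)
    qed (auto simp: cech_diff_times cech_cocycles_def fun_eq_iff)
  next
    case False
    have "card B \<noteq> p" for B :: "'x set"
      using card_mono[of UNIV B] False by auto
    then have "cech_cocycles I p (strand d A) = {0}" for A :: "('x + 'y) set"
      using additive.zero[OF additive_cech_diff]
      by (auto simp: cech_cocycles_def cech_cochains_def fun_eq_iff)
    then show ?thesis by (simp add: koszul_exact_zero[OF ops])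
  qed
qed

definition ideal_strand ::
    "('x::finite, 'y::finite, 'k::field) bipoly set \<Rightarrow> int \<times> int \<Rightarrow> ('x + 'y) set
     \<Rightarrow> ('x, 'y, 'k) bipoly set" where
  "ideal_strand I d A = {f \<in> I. bihomogeneous (strand d A) f}"

text \<open>
  In the degrees that occur, the first Cech differential maps \<open>I\<close> isomorphically onto the \<open>1\<close>-cocycles: it is
  injective because \<open>S\<close> embeds into its localization at each \<open>x\<^sub>i\<close>, and onto because the first cohomology vanishes.
\<close>

lemma koszul_exact_ideal_strand:
  fixes I :: "('x::{finite,linorder}, 'y::finite, 'k::field) bipoly set"
  assumes I: "is_ideal I" and vs: "distinct vs" "set vs = UNIV"
    and van: "\<And>p (A :: ('x + 'y) set). cech_cocycles I (Suc p) (strand d A) = cech_diff ` cech_cochains I p (strand d A)"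
  shows "koszul_exact (\<lambda>v. (*) (variable v)) vs (ideal_strand I d)"
proof -
  \<comment> \<open>An element of \<open>I\<close> as a Cech cochain of degree \<open>0\<close>.\<close>
  let ?emb = "\<lambda>f B. if B = {} then to_laurent f else 0 :: ('x, 'y, 'k) bilaurent"
  let ?\<phi> = "\<lambda>f. cech_diff (?emb f)"
  have emb: "?emb ` ideal_strand I d A = cech_cochains I 0 (strand d A)" for A
  proof -
    have loc: "x_localization I {} = to_laurent ` I"
      by (auto simp: x_localization_def)
    show ?thesis
    proof (intro equalityI subsetI)
      fix c assume c: "c \<in> cech_cochains I 0 (strand d A)"
      then have c0: "c B = 0" if "B \<noteq> {}" for B
        using that by (simp add: cech_cochains_def split: if_splits)
      have "c {} \<in> to_laurent ` I" "laurent_bihomogeneous (strand d A) (c {})"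
        using c loc by (auto simp: cech_cochains_def dest: spec[of _ "{}"])
      then obtain f where "f \<in> ideal_strand I d A" "c {} = to_laurent f"
        by (auto simp: ideal_strand_def laurent_bihomogeneous_to_laurent)
      then show "c \<in> ?emb ` ideal_strand I d A"
        using c0 by (auto simp: image_iff fun_eq_iff intro!: bexI[of _ f])
    qed (auto simp: cech_cochains_def loc ideal_strand_def laurent_bihomogeneous_to_laurent split: if_splits)
  qed
  have emb_add: "?emb (f + g) = ?emb f + ?emb g" for f g
    by (simp add: fun_eq_iff to_laurent_add)
  have emb_variable: "?emb (variable v * f) = (\<lambda>B. variable v * ?emb f B)" for v f
    by (simp add: fun_eq_iff to_laurent_monomial)
  show ?thesis
  proof (rule koszul_exact_iso[where \<phi> = ?\<phi> and Y = "\<lambda>v f B. variable v * f B"])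
    show "additive ?\<phi>"
      by (rule additive.intro) (simp only: emb_add additive.add[OF additive_cech_diff])
    show "?\<phi> (variable v * f) = (\<lambda>B. variable v * ?\<phi> f B)" for v f
      by (simp only: emb_variable cech_diff_times)
    show "f = 0" if "?\<phi> f = 0" for f
    proof -
      have "?\<phi> f {j} = to_laurent f" for j :: 'x
      proof -
        have "?\<phi> f {j} = (- 1) ^ card {k \<in> {j}. k < j} * to_laurent f"
          by (simp add: cech_diff_def)
        also have "{k \<in> {j}. k < j} = {}" by auto
        finally show ?thesis by simp
      qed
      then show ?thesis using that to_laurent_eq_0 by (metis zero_fun_apply)
    qed
    show "?\<phi> ` ideal_strand I d A = cech_cocycles I (Suc 0) (strand d A)" for A
      unfolding van emb[symmetric] image_image ..
    show "koszul_exact (\<lambda>v f B. variable v * f B) vs (\<lambda>A. cech_cocycles I (Suc 0) (strand d A))"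
      by (rule koszul_exact_cech_cocycles[OF I vs van]) simp
  qed
qed

section \<open>Koszul cycles over the polynomial ring\<close>

(* The exponent 1 is part of the abbreviation for variables; rewriting it to Suc 0 would keep the
   lemmas about variables from matching. *)
declare One_nat_def [simp del]

text \<open>
  Division by the variable \<open>v\<close> that discards the monomials not divisible by it: a left inverse of
  multiplication by \<open>v\<close>.
\<close>

definition lower :: "'v \<Rightarrow> (('v \<Rightarrow>\<^sub>0 nat) \<Rightarrow>\<^sub>0 'k::zero) \<Rightarrow> ('v \<Rightarrow>\<^sub>0 nat) \<Rightarrow>\<^sub>0 'k" where
  "lower v = Poly_Mapping.map_key ((+) (Poly_Mapping.single v 1))"

lemma lookup_lower: "Poly_Mapping.lookup (lower v f) e = Poly_Mapping.lookup f (Poly_Mapping.single v 1 + e)"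
  by (simp add: lower_def Poly_Mapping.map_key.rep_eq inj_on_def)

lemma additive_lower: "additive (lower v :: _ \<Rightarrow> _ \<Rightarrow>\<^sub>0 'k::ab_group_add)"
  by (rule additive.intro) (rule poly_mapping_eqI, simp add: lookup_lower lookup_add)

lemma lower_zero: "lower v (0 :: _ \<Rightarrow>\<^sub>0 'k::ab_group_add) = 0"
  by (rule additive.zero[OF additive_lower])

lemma lookup_variable_times:
  fixes f :: "('v \<Rightarrow>\<^sub>0 nat) \<Rightarrow>\<^sub>0 'k::comm_ring_1"
  shows "Poly_Mapping.lookup (variable v * f) e
    = (if Poly_Mapping.lookup e v = 0 then 0
       else Poly_Mapping.lookup f (e - Poly_Mapping.single v 1))"
proof (cases "Poly_Mapping.lookup e v = 0")
  case True
  then have "e \<notin> Poly_Mapping.keys (variable v * f)"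
    by (auto simp: keys_single_times lookup_add)
  then show ?thesis using True by (simp add: in_keys_iff)
next
  case False
  then have "e = Poly_Mapping.single v 1 + (e - Poly_Mapping.single v 1)"
    by (intro poly_mapping_eqI) (auto simp: lookup_add lookup_minus lookup_single when_def)
  then show ?thesis using False lookup_single_times by metis
qed

lemma lower_variable_times:
  fixes f :: "('v \<Rightarrow>\<^sub>0 nat) \<Rightarrow>\<^sub>0 'k::comm_ring_1"
  shows "lower v (variable v * f) = f"
  by (rule poly_mapping_eqI) (simp add: lookup_lower lookup_single_times)

lemma lower_commute:
  fixes f :: "('v \<Rightarrow>\<^sub>0 nat) \<Rightarrow>\<^sub>0 'k::comm_ring_1"
  assumes "w \<noteq> v"
  shows "lower v (variable w * f) = variable w * lower v f"
proof (rule poly_mapping_eqI)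
  fix e :: "'v \<Rightarrow>\<^sub>0 nat"
  have "Poly_Mapping.single v 1 + e - Poly_Mapping.single w 1
      = Poly_Mapping.single v 1 + (e - Poly_Mapping.single w 1)"
    using assms by (intro poly_mapping_eqI) (auto simp: lookup_add lookup_minus lookup_single when_def)
  then show "Poly_Mapping.lookup (lower v (variable w * f)) e
      = Poly_Mapping.lookup (variable w * lower v f) e"
    using assms
    by (simp add: lookup_lower lookup_variable_times lookup_add lookup_single when_def)
qed

lemma keys_minus_variable_times_lower:
  fixes f :: "('v \<Rightarrow>\<^sub>0 nat) \<Rightarrow>\<^sub>0 'k::comm_ring_1"
  shows "Poly_Mapping.keys (f - variable v * lower v f)
    \<subseteq> {e \<in> Poly_Mapping.keys f. Poly_Mapping.lookup e v = 0}"
proof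
  fix e assume e: "e \<in> Poly_Mapping.keys (f - variable v * lower v f)"
  have "Poly_Mapping.single v 1 + (e - Poly_Mapping.single v 1) = e" if "Poly_Mapping.lookup e v \<noteq> 0"
    using that by (intro poly_mapping_eqI) (auto simp: lookup_add lookup_minus lookup_single when_def)
  then have "Poly_Mapping.lookup (f - variable v * lower v f) e
      = (if Poly_Mapping.lookup e v = 0 then Poly_Mapping.lookup f e else 0)"
    by (simp add: lookup_minus lookup_variable_times lookup_lower)
  then show "e \<in> {e \<in> Poly_Mapping.keys f. Poly_Mapping.lookup e v = 0}"
    using e by (auto simp: in_keys_iff split: if_splits)
qed

definition poly_strand ::
    "int \<times> int \<Rightarrow> ('x + 'y) set \<Rightarrow> ('x::finite, 'y::finite, 'k::field) bipoly set" where
  "poly_strand d A = {f. bihomogeneous (strand d A) f}"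

lemma bihomogeneous_0 [simp]: "bihomogeneous d 0"
  by (simp add: bihomogeneous_def)

lemma bihomogeneous_diff:
  fixes f g :: "('x::finite, 'y::finite, 'k::ab_group_add) bipoly"
  shows "bihomogeneous d f \<Longrightarrow> bihomogeneous d g \<Longrightarrow> bihomogeneous d (f - g)"
  by (auto simp: bihomogeneous_def in_keys_iff lookup_minus)

lemma bihomogeneous_mult:
  fixes f g :: "('x::finite, 'y::finite, 'k::comm_ring_1) bipoly"
  assumes "bihomogeneous d f" "bihomogeneous d' g"
  shows "bihomogeneous (d + d') (f * g)"
  using assms keys_mult[of f g] by (fastforce simp: bihomogeneous_def map_int_add bideg_add)

lemma bihomogeneous_sum:
  fixes f :: "'i \<Rightarrow> ('x::finite, 'y::finite, 'k::comm_ring_1) bipoly"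
  shows "(\<And>i. i \<in> A \<Longrightarrow> bihomogeneous d (f i)) \<Longrightarrow> bihomogeneous d (\<Sum>i\<in>A. f i)"
  using keys_sum[of f A] by (fastforce simp: bihomogeneous_def)

lemma bihomogeneous_variable: "bihomogeneous (var_degree v) (variable v)"
  by (simp add: bihomogeneous_def bideg_single)

lemma bihomogeneous_lower:
  assumes "bihomogeneous (var_degree v + d) f"
  shows "bihomogeneous d (lower v f)"
  using assms by (auto simp: bihomogeneous_def in_keys_iff lookup_lower map_int_add bideg_add bideg_single
      dest!: bspec[of _ _ "Poly_Mapping.single v 1 + _"])

lemma koszul_family_poly_strand:
  "koszul_family (\<lambda>v. (*) (variable v))
    (poly_strand d :: _ \<Rightarrow> ('x::finite, 'y::finite, 'k::field) bipoly set)"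
proof -
  have "bihomogeneous (strand d A) (variable v * f)"
    if "v \<notin> A" "bihomogeneous (strand d (insert v A)) f"
    for v A and f :: "('x, 'y, 'k) bipoly"
    using bihomogeneous_mult[OF bihomogeneous_variable that(2)] strand_insert[OF that(1)] by simp
  then show ?thesis
    by (auto simp: koszul_family_def poly_strand_def intro: bihomogeneous_diff)
qed

lemma homotopy_operator_lower:
  "homotopy_operator (\<lambda>v. (*) (variable v)) v
    (lower v :: (('v \<Rightarrow>\<^sub>0 nat) \<Rightarrow>\<^sub>0 'k::comm_ring_1) \<Rightarrow> _)"
  by (intro homotopy_operator.intro commuting_operators_ring homotopy_operator_axioms.intro
      additive_lower lower_commute)

text \<open>
  Adding boundaries, one variable \<open>v\<close> at a time, a cycle is made to vanish at all sets that meet \<open>W\<close> while its coefficient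
  at the empty set loses the monomials that involve a variable in \<open>W\<close>. Each step subtracts the boundary of
  the contraction along \<open>v\<close> with \<open>lower v\<close>; the homotopy formula gives what remains.
\<close>

lemma koszul_cycle_reduce:
  fixes c :: "('x::finite + 'y::finite) set \<Rightarrow> ('x, 'y, 'k::field) bipoly"
  assumes vs: "distinct vs" "set vs = UNIV"
    and c: "\<And>A. c A \<in> poly_strand d A" "koszul (\<lambda>v. (*) (variable v)) vs c = 0"
    and W: "finite W"
  shows "\<exists>u. (\<forall>A. u A \<in> poly_strand d A) \<and>
    (\<forall>B. B \<inter> W \<noteq> {} \<longrightarrow> (c - koszul (\<lambda>v. (*) (variable v)) vs u) B = 0) \<and>
    Poly_Mapping.keys ((c - koszul (\<lambda>v. (*) (variable v)) vs u) {})
      \<subseteq> {e \<in> Poly_Mapping.keys (c {}). \<forall>w\<in>W. Poly_Mapping.lookup e w = 0}"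
  using W
proof induction
  case empty
  interpret commuting_operators "\<lambda>v. (*) (variable v :: ('x, 'y, 'k) bipoly)"
    by (rule commuting_operators_ring)
  have "koszul (\<lambda>v. (*) (variable v :: ('x, 'y, 'k) bipoly)) vs (\<lambda>A. 0) B = 0" for B
    using koszul_zero[of vs] by (simp add: zero_fun_def fun_eq_iff)
  then show ?case
    by (intro exI[of _ "\<lambda>A. 0"]) (simp add: koszul_family_zero[OF koszul_family_poly_strand])
next
  case (insert v W)
  interpret homotopy_operator "\<lambda>v. (*) (variable v :: ('x, 'y, 'k) bipoly)" v "lower v"
    by (rule homotopy_operator_lower)
  let ?K = "koszul (\<lambda>v. (*) (variable v :: ('x, 'y, 'k) bipoly)) vs"
  obtain u where u': "\<forall>A. u A \<in> poly_strand d A"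
    "\<forall>B. B \<inter> W \<noteq> {} \<longrightarrow> (c - ?K u) B = 0"
    "Poly_Mapping.keys ((c - ?K u) {})
      \<subseteq> {e \<in> Poly_Mapping.keys (c {}). \<forall>w\<in>W. Poly_Mapping.lookup e w = 0}"
    using insert.IH by (elim exE conjE) (rule that)
  define c' where "c' = c - ?K u"
  define h where "h = contraction v (lower v) vs c'"
  have vanish: "c' B = 0" if "B \<inter> W \<noteq> {}" for B
    unfolding c'_def by (rule u'(2)[rule_format, OF that])
  have keys: "Poly_Mapping.keys (c' {})
      \<subseteq> {e \<in> Poly_Mapping.keys (c {}). \<forall>w\<in>W. Poly_Mapping.lookup e w = 0}"
    using u'(3) by (simp only: c'_def)
  have mem: "c' A \<in> poly_strand d A" for A
    unfolding c'_def minus_apply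
    by (rule koszul_family_diff[OF koszul_family_poly_strand c(1)])
      (rule koszul_in_family[OF koszul_family_poly_strand u'(1)[rule_format]])
  have low: "lower v z \<in> poly_strand d (insert v A)" if "v \<notin> A" "z \<in> poly_strand d A"
    for A and z :: "('x, 'y, 'k) bipoly"
    using that strand_insert[of v A d] by (simp add: poly_strand_def bihomogeneous_lower)
  have mem_h: "h A \<in> poly_strand d A" for A
    unfolding h_def by (rule contraction_in_family[OF koszul_family_poly_strand mem low])
  have "?K c' = 0"
    unfolding c'_def by (simp only: koszul_diff koszul_koszul[OF vs(1)] c(2) diff_self)
  then have Kh: "?K h B = (if v \<in> B then c' B else variable v * lower v (c' B))" for B
    using homotopy[of vs c' B] vs by (simp add: h_def lower_variable_times contraction_zero)
  have new: "(c - ?K (u + h)) B = (if v \<in> B then 0 else c' B - variable v * lower v (c' B))" for B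
  proof -
    have "c - ?K (u + h) = c' - ?K h" by (simp only: c'_def koszul_add diff_diff_add)
    then have "(c - ?K (u + h)) B = c' B - ?K h B" by (simp only: minus_apply)
    then show ?thesis unfolding Kh by (cases "v \<in> B") simp_all
  qed
  have "(u + h) A \<in> poly_strand d A" for A
    unfolding plus_fun_apply
    by (rule koszul_family_add[OF koszul_family_poly_strand u'(1)[rule_format] mem_h])
  moreover have "(c - ?K (u + h)) B = 0" if "B \<inter> insert v W \<noteq> {}" for B
  proof (cases "v \<in> B")
    case False
    then have "c' B = 0" using that by (intro vanish) auto
    then show ?thesis using False by (simp only: new lower_zero) simp
  qed (simp only: new if_True)
  moreover have "Poly_Mapping.keys ((c - ?K (u + h)) {})
      \<subseteq> {e \<in> Poly_Mapping.keys (c {}). \<forall>w\<in>insert v W. Poly_Mapping.lookup e w = 0}"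
    using keys keys_minus_variable_times_lower[of "c' {}" v]
    unfolding new empty_iff if_False by fast
  ultimately show ?case by (intro exI[of _ "u + h"] conjI allI impI)
qed

text \<open>
  Reduced along all variables, a cycle is concentrated at the empty set with a constant
  coefficient, which is zero by assumption. This is the statement
  that the Koszul complex resolves the residue field, in the form that does not refer to homological degrees.
\<close>

lemma koszul_cycle_bounds:
  fixes c :: "('x::finite + 'y::finite) set \<Rightarrow> ('x, 'y, 'k::field) bipoly"
  assumes vs: "distinct vs" "set vs = UNIV"
    and c: "\<And>A. c A \<in> poly_strand d A" "koszul (\<lambda>v. (*) (variable v)) vs c = 0"
    and const: "Poly_Mapping.lookup (c {}) 0 = 0"
  shows "\<exists>u. (\<forall>A. u A \<in> poly_strand d A) \<and> koszul (\<lambda>v. (*) (variable v)) vs u = c"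
proof -
  let ?K = "koszul (\<lambda>v. (*) (variable v :: ('x, 'y, 'k) bipoly)) vs"
  obtain u where u: "\<And>A. u A \<in> poly_strand d A" "\<And>B. B \<noteq> {} \<Longrightarrow> (c - ?K u) B = 0"
    "Poly_Mapping.keys ((c - ?K u) {})
      \<subseteq> {e \<in> Poly_Mapping.keys (c {}). \<forall>w. Poly_Mapping.lookup e w = 0}"
    using koszul_cycle_reduce[OF vs c finite[of UNIV]] by auto
  have "e = 0" if "\<forall>w. Poly_Mapping.lookup e w = 0" for e :: "'x + 'y \<Rightarrow>\<^sub>0 nat"
    using that by (intro poly_mapping_eqI) simp
  then have "Poly_Mapping.keys ((c - ?K u) {}) = {}"
    using u(3) const in_keys_iff[of 0 "c {}"] by blast
  then have "(c - ?K u) B = 0" for B using u(2) by (cases "B = {}") auto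
  then have "?K u = c" by (auto simp: fun_eq_iff)
  then show ?thesis using u(1) by blast
qed

section \<open>Homogeneous components\<close>

definition homogeneous_component ::
    "int \<times> int \<Rightarrow> ('x::finite, 'y::finite, 'k::comm_ring_1) bipoly \<Rightarrow> ('x, 'y, 'k) bipoly" where
  "homogeneous_component d f =
     (\<Sum>e\<in>{e \<in> Poly_Mapping.keys f. bideg (Poly_Mapping.map int e) = d}.
       Poly_Mapping.single e (Poly_Mapping.lookup f e))"

lemma lookup_homogeneous_component:
  "Poly_Mapping.lookup (homogeneous_component d f) e
    = (if bideg (Poly_Mapping.map int e) = d then Poly_Mapping.lookup f e else 0)"
proof -
  have "Poly_Mapping.lookup (homogeneous_component d f) e
      = (\<Sum>e'\<in>{e \<in> Poly_Mapping.keys f. bideg (Poly_Mapping.map int e) = d}.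
          if e' = e then Poly_Mapping.lookup f e' else 0)"
    unfolding homogeneous_component_def lookup_sum lookup_single when_def by simp
  then show ?thesis by (simp add: in_keys_iff)
qed

lemma bihomogeneous_component: "bihomogeneous d (homogeneous_component d f)"
  by (auto simp: bihomogeneous_def in_keys_iff lookup_homogeneous_component split: if_splits)

lemma homogeneous_component_id: "bihomogeneous d f \<Longrightarrow> homogeneous_component d f = f"
  by (rule poly_mapping_eqI) (auto simp: lookup_homogeneous_component bihomogeneous_def in_keys_iff)

lemma homogeneous_component_add:
  "homogeneous_component d (f + g) = homogeneous_component d f + homogeneous_component d g"
  by (rule poly_mapping_eqI) (simp add: lookup_homogeneous_component lookup_add)

lemma homogeneous_component_sum:
  "homogeneous_component d (\<Sum>i\<in>A. f i) = (\<Sum>i\<in>A. homogeneous_component d (f i))"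
  by (rule poly_mapping_eqI) (simp add: lookup_homogeneous_component lookup_sum)

lemma homogeneous_component_mult:
  assumes h: "bihomogeneous d' h"
  shows "homogeneous_component (d' + d) (h * f) = h * homogeneous_component d f"
proof -
  let ?f = "homogeneous_component d f" and ?r = "f - homogeneous_component d f"
  have "bideg (Poly_Mapping.map int e) \<noteq> d" if "e \<in> Poly_Mapping.keys ?r" for e
    using that by (auto simp: in_keys_iff lookup_minus lookup_homogeneous_component split: if_splits)
  then have "bideg (Poly_Mapping.map int e) \<noteq> d' + d" if "e \<in> Poly_Mapping.keys (h * ?r)" for e
    using that keys_mult[of h ?r] h by (fastforce simp: bihomogeneous_def map_int_add bideg_add)
  then have "homogeneous_component (d' + d) (h * ?r) = 0"
    by (intro poly_mapping_eqI) (auto simp: lookup_homogeneous_component in_keys_iff)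
  moreover have "homogeneous_component (d' + d) (h * ?f) = h * ?f"
    by (intro homogeneous_component_id bihomogeneous_mult h bihomogeneous_component)
  moreover have "h * f = h * ?f + h * ?r" by (simp add: algebra_simps)
  ultimately show ?thesis by (metis homogeneous_component_add add_0_right)
qed

text \<open>
  If a homogeneous element is the image of \<open>w\<close> under a row of homogeneous entries, then it is already
  the image of the homogeneous components of \<open>w\<close> of the matching degrees. This makes the ungraded exactness
  of a resolution into exactness in each degree. As the components depend on the columns only, all rows of a
  matrix can be treated with the same preimage.
\<close>

lemma homogeneous_preimage:
  assumes E: "\<And>l. l < n \<Longrightarrow> bihomogeneous (r l - r') (E l)"
    and z: "bihomogeneous (d - r') (\<Sum>l<n. E l * w l)"
  shows "(\<Sum>l<n. E l * homogeneous_component (d - r l) (w l)) = (\<Sum>l<n. E l * w l)"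
proof -
  have "homogeneous_component (d - r') (E l * w l) = E l * homogeneous_component (d - r l) (w l)"
    if "l < n" for l
    using homogeneous_component_mult[OF E[OF that], of "d - r l" "w l"] by simp
  then have "(\<Sum>l<n. E l * homogeneous_component (d - r l) (w l))
      = homogeneous_component (d - r') (\<Sum>l<n. E l * w l)"
    by (simp add: homogeneous_component_sum)
  then show ?thesis using homogeneous_component_id[OF z] by simp
qed

lemma lookup_mult_zero_left:
  fixes f h :: "('v \<Rightarrow>\<^sub>0 nat) \<Rightarrow>\<^sub>0 'k::comm_ring_1"
  assumes "Poly_Mapping.lookup h 0 = 0"
  shows "Poly_Mapping.lookup (h * f) 0 = 0"
proof -
  have "a = 0" if "a + b = 0" for a b :: "'v \<Rightarrow>\<^sub>0 nat"
  proof (rule poly_mapping_eqI)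
    show "Poly_Mapping.lookup a v = Poly_Mapping.lookup 0 v" for v
      using that lookup_add[of a b v] by simp
  qed
  moreover have "0 \<notin> Poly_Mapping.keys h" using assms by (simp add: in_keys_iff)
  ultimately have "0 \<notin> Poly_Mapping.keys (h * f)"
    using keys_mult[of h f] by fastforce
  then show ?thesis by (simp add: in_keys_iff)
qed

lemma irrelevant_ideal_lookup_zero:
  fixes f :: "('x, 'y, 'k::field) bipoly"
  assumes "f \<in> irrelevant_ideal"
  shows "Poly_Mapping.lookup f 0 = 0"
proof -
  let ?J = "{f :: ('x, 'y, 'k) bipoly. Poly_Mapping.lookup f 0 = 0}"
  have "Poly_Mapping.lookup (c * f) 0 = 0" if "Poly_Mapping.lookup f 0 = 0"
    for c f :: "('x, 'y, 'k) bipoly"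
    using lookup_mult_zero_left[OF that, of c] by (simp only: mult.commute)
  then have "Modules.module.subspace (*) ?J"
    by (simp add: Modules.module.subspace_def[OF module_times] lookup_add)
  moreover have "Poly_Mapping.single v (1::nat) \<noteq> 0" for v :: "'x + 'y"
    by (metis lookup_single_eq lookup_zero zero_neq_one)
  then have "{variable v | v. v \<in> UNIV} \<subseteq> ?J"
    by (auto simp: lookup_single when_def)
  ultimately have "irrelevant_ideal \<subseteq> ?J"
    unfolding irrelevant_ideal_def by (intro Modules.module.span_minimal[OF module_times])
  then show ?thesis using assms by blast
qed

section \<open>Syzygies in a minimal resolution\<close>

locale bigraded_resolution =
  fixes I :: "('x::finite, 'y::finite, 'k::field) bipoly set"
    and ds :: "nat \<Rightarrow> (int \<times> int) list" and g D
  assumes resolution: "minimal_bigraded_free_resolution I ds g D"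
begin

text \<open>
  Elements of \<open>F\<^sub>i\<close> are represented by functions on indices that vanish beyond the rank, since such functions
  form a group under pointwise operations.
\<close>

definition augmentation :: "(nat \<Rightarrow> ('x, 'y, 'k) bipoly) \<Rightarrow> ('x, 'y, 'k) bipoly" where
  "augmentation f = (\<Sum>l<length (ds 0). g $ l * f l)"

definition differential :: "nat \<Rightarrow> (nat \<Rightarrow> ('x, 'y, 'k) bipoly) \<Rightarrow> nat \<Rightarrow> ('x, 'y, 'k) bipoly" where
  "differential i f = (\<lambda>k. if k < length (ds i)
     then \<Sum>l<length (ds (Suc i)). D i $$ (k, l) * f l else 0)"

definition free_strand ::
    "int \<times> int \<Rightarrow> nat \<Rightarrow> ('x + 'y) set \<Rightarrow> (nat \<Rightarrow> ('x, 'y, 'k) bipoly) set" where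
  "free_strand d i A =
     {f. \<forall>k. f k \<in> (if k < length (ds i) then poly_strand (d - ds i ! k) A else {0})}"

text \<open>
  For the family belonging to a degree \<open>d\<close>, the kernel of \<open>F\<^sub>i \<rightarrow> F\<^sub>i\<^sub>-\<^sub>1\<close>, where \<open>F\<^sub>-\<^sub>1\<close> is \<open>I\<close>.
\<close>

primrec syzygy :: "int \<times> int \<Rightarrow> nat \<Rightarrow> ('x + 'y) set \<Rightarrow> (nat \<Rightarrow> ('x, 'y, 'k) bipoly) set" where
  "syzygy d 0 A = {f \<in> free_strand d 0 A. augmentation f = 0}"
| "syzygy d (Suc i) A = {f \<in> free_strand d (Suc i) A. differential i f = 0}"

lemmas resolution_unfolded = resolution[unfolded minimal_bigraded_free_resolution_def]
lemmas resolution_tail = resolution_unfolded[THEN conjunct2, THEN conjunct2]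

lemma carrier:
  "g \<in> carrier_vec (length (ds 0))" "D i \<in> carrier_mat (length (ds i)) (length (ds (Suc i)))"
  using resolution_unfolded[THEN conjunct1]
    resolution_unfolded[THEN conjunct2, THEN conjunct1, rule_format] .

lemma augmentation_bihomogeneous: "l < length (ds 0) \<Longrightarrow> bihomogeneous (ds 0 ! l) (g $ l)"
  using resolution_tail[THEN conjunct1] by simp

lemma differential_bihomogeneous: "k < length (ds i) \<Longrightarrow> l < length (ds (Suc i))
    \<Longrightarrow> bihomogeneous (ds (Suc i) ! l - ds i ! k) (D i $$ (k, l))"
  using resolution_tail[THEN conjunct2, THEN conjunct1] by (simp add: minus_prod_def)

lemmas image_augmentation = resolution_tail[THEN conjunct2, THEN conjunct2, THEN conjunct1]
  and kernel_augmentation =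
    resolution_tail[THEN conjunct2, THEN conjunct2, THEN conjunct2, THEN conjunct1,
      unfolded One_nat_def]
  and kernel_differential =
    resolution_tail[THEN conjunct2, THEN conjunct2, THEN conjunct2, THEN conjunct2,
      THEN conjunct1, rule_format]
  and minimal =
    resolution_tail[THEN conjunct2, THEN conjunct2, THEN conjunct2, THEN conjunct2,
      THEN conjunct2, rule_format]

lemma scalar_prod_augmentation: "g \<bullet> vec (length (ds 0)) f = augmentation f"
  by (simp add: augmentation_def scalar_prod_def atLeast0LessThan)

lemma mult_vec_differential:
  "D i *\<^sub>v vec (length (ds (Suc i))) f = vec (length (ds i)) (differential i f)"
  using carrier(2)[of i]
  by (intro eq_vecI) (auto simp: differential_def scalar_prod_def atLeast0LessThan)

lemma carrier_vec_eq_vec: "v \<in> carrier_vec n \<Longrightarrow> v = vec n (\<lambda>k. v $ k)"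
  by (intro eq_vecI) auto

lemma vec_eq_imp: "vec n f = vec n h \<Longrightarrow> k < n \<Longrightarrow> f k = h k"
  by (metis index_vec)

lemma additive_augmentation: "additive augmentation"
  by (rule additive.intro) (simp add: augmentation_def distrib_left sum.distrib)

lemma additive_differential: "additive (differential i)"
  by (rule additive.intro) (auto simp: differential_def fun_eq_iff distrib_left sum.distrib)

lemma augmentation_times: "augmentation (\<lambda>k. h * f k) = h * augmentation f"
  by (simp add: augmentation_def sum_distrib_left mult.left_commute)

lemma differential_times: "differential i (\<lambda>k. h * f k) = (\<lambda>k. h * differential i f k)"
  by (rule ext) (simp add: differential_def sum_distrib_left mult.left_commute)

lemma free_strandD:
  "f \<in> free_strand d i A \<Longrightarrow> k < length (ds i) \<Longrightarrow> bihomogeneous (strand d A - ds i ! k) (f k)"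
  "f \<in> free_strand d i A \<Longrightarrow> \<not> k < length (ds i) \<Longrightarrow> f k = 0"
  by (auto simp: free_strand_def poly_strand_def strand_diff dest!: spec[of _ k])

lemma free_strandI:
  assumes "\<And>k. k < length (ds i) \<Longrightarrow> bihomogeneous (strand d A - ds i ! k) (f k)"
    "\<And>k. \<not> k < length (ds i) \<Longrightarrow> f k = 0"
  shows "f \<in> free_strand d i A"
  using assms by (simp add: free_strand_def poly_strand_def strand_diff)

lemma augmentation_onto: "augmentation ` free_strand d 0 A = ideal_strand I d A"
proof (intro equalityI subsetI)
  fix z assume "z \<in> augmentation ` free_strand d 0 A"
  then obtain f where f: "f \<in> free_strand d 0 A" "z = augmentation f" by blast
  have "bihomogeneous (strand d A) (g $ l * f l)" if "l < length (ds 0)" for l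
    using bihomogeneous_mult[OF augmentation_bihomogeneous[OF that] free_strandD(1)[OF f(1) that]]
    by simp
  then have "bihomogeneous (strand d A) z"
    unfolding f(2) augmentation_def by (intro bihomogeneous_sum) simp
  moreover have "z \<in> I"
    using image_augmentation scalar_prod_augmentation[of f] f(2)
    by (metis (mono_tags, lifting) mem_Collect_eq vec_carrier)
  ultimately show "z \<in> ideal_strand I d A" by (simp add: ideal_strand_def)
next
  fix z assume "z \<in> ideal_strand I d A"
  then have z: "z \<in> I" "bihomogeneous (strand d A) z" by (auto simp: ideal_strand_def)
  then obtain v where v: "v \<in> carrier_vec (length (ds 0))" "z = g \<bullet> v"
    using image_augmentation by blast
  let ?w = "\<lambda>k. v $ k"
  have zw: "z = augmentation ?w"
    using v carrier_vec_eq_vec[OF v(1)] scalar_prod_augmentation[of ?w] by simp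
  let ?f = "\<lambda>l. if l < length (ds 0) then homogeneous_component (strand d A - ds 0 ! l) (?w l) else 0"
  have "augmentation ?f = (\<Sum>l<length (ds 0). g $ l * homogeneous_component (strand d A - ds 0 ! l) (?w l))"
    unfolding augmentation_def by (intro sum.cong) auto
  also have "\<dots> = z"
    unfolding zw augmentation_def
  proof (rule homogeneous_preimage[where r' = 0])
    show "bihomogeneous (strand d A - 0) (\<Sum>l<length (ds 0). g $ l * v $ l)"
      using z(2) unfolding zw augmentation_def by simp
  qed (simp add: augmentation_bihomogeneous)
  finally show "z \<in> augmentation ` free_strand d 0 A"
    by (intro image_eqI[of _ _ ?f] free_strandI) (auto simp: bihomogeneous_component)
qed

lemma differential_in_free_strand:
  assumes "f \<in> free_strand d (Suc i) A"
  shows "differential i f \<in> free_strand d i A"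
proof (rule free_strandI)
  fix k assume k: "k < length (ds i)"
  have "bihomogeneous (strand d A - ds i ! k) (D i $$ (k, l) * f l)" if "l < length (ds (Suc i))" for l
    using bihomogeneous_mult[OF differential_bihomogeneous[OF k that] free_strandD(1)[OF assms that]]
    by simp
  then show "bihomogeneous (strand d A - ds i ! k) (differential i f k)"
    using k unfolding differential_def by (auto intro!: bihomogeneous_sum)
qed (simp add: differential_def)

lemma syzygy_subset: "f \<in> syzygy d i A \<Longrightarrow> f \<in> free_strand d i A"
  by (cases i) auto

lemma syzygy_vec:
  assumes "f \<in> free_strand d i A"
  shows "f \<in> syzygy d i A \<longleftrightarrow>
    (\<exists>w. w \<in> carrier_vec (length (ds (Suc i))) \<and> vec (length (ds i)) f = D i *\<^sub>v w)"
proof (cases i)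
  case 0
  have "f \<in> syzygy d i A \<longleftrightarrow>
      vec (length (ds 0)) f \<in> {v \<in> carrier_vec (length (ds 0)). g \<bullet> v = 0}"
    using assms 0 by (simp add: scalar_prod_augmentation)
  then show ?thesis unfolding kernel_augmentation using 0 by auto
next
  case (Suc j)
  have "differential j f = 0 \<longleftrightarrow> vec (length (ds j)) (differential j f) = 0\<^sub>v (length (ds j))"
    by (auto simp: vec_eq_iff fun_eq_iff differential_def)
  then have "f \<in> syzygy d i A \<longleftrightarrow> vec (length (ds (Suc j))) f
      \<in> {v \<in> carrier_vec (length (ds (Suc j))). D j *\<^sub>v v = 0\<^sub>v (length (ds j))}"
    using assms Suc by (simp add: mult_vec_differential)
  then show ?thesis unfolding kernel_differential using Suc by auto
qed

lemma differential_onto: "differential i ` free_strand d (Suc i) A = syzygy d i A"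
proof (intro equalityI subsetI)
  fix z assume "z \<in> differential i ` free_strand d (Suc i) A"
  then obtain f where f: "f \<in> free_strand d (Suc i) A" "z = differential i f" by blast
  have "\<exists>w. w \<in> carrier_vec (length (ds (Suc i))) \<and>
      vec (length (ds i)) (differential i f) = D i *\<^sub>v w"
    by (intro exI[of _ "vec (length (ds (Suc i))) f"] conjI vec_carrier
        mult_vec_differential[symmetric])
  then show "z \<in> syzygy d i A"
    unfolding f(2) by (subst syzygy_vec[OF differential_in_free_strand[OF f(1)]])
next
  fix z assume syz: "z \<in> syzygy d i A"
  then have z: "z \<in> free_strand d i A" by (rule syzygy_subset)
  then obtain v where v: "v \<in> carrier_vec (length (ds (Suc i)))" "vec (length (ds i)) z = D i *\<^sub>v v"
    using syz syzygy_vec[OF z] by blast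
  define w where "w = (\<lambda>k. v $ k)"
  define f where "f = (\<lambda>l. if l < length (ds (Suc i))
    then homogeneous_component (strand d A - ds (Suc i) ! l) (w l) else 0)"
  have "v = vec (length (ds (Suc i))) w" unfolding w_def by (rule carrier_vec_eq_vec[OF v(1)])
  then have "vec (length (ds i)) z = vec (length (ds i)) (differential i w)"
    by (simp only: v(2) mult_vec_differential)
  then have "z k = differential i w k" if "k < length (ds i)" for k
    using that by (rule vec_eq_imp)
  then have zw: "z k = (\<Sum>l<length (ds (Suc i)). D i $$ (k, l) * w l)" if "k < length (ds i)" for k
    using that by (simp only: differential_def if_True)
  have "differential i f k = z k" for k
  proof (cases "k < length (ds i)")
    case k: True
    then have "differential i f k = (\<Sum>l<length (ds (Suc i)). D i $$ (k, l) * f l)"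
      by (simp only: differential_def if_True)
    also have "\<dots> = (\<Sum>l<length (ds (Suc i)). D i $$ (k, l) *
        homogeneous_component (strand d A - ds (Suc i) ! l) (w l))"
      by (intro sum.cong refl) (simp only: f_def lessThan_iff if_True)
    also have "\<dots> = (\<Sum>l<length (ds (Suc i)). D i $$ (k, l) * w l)"
    proof (rule homogeneous_preimage[where r' = "ds i ! k"])
      show "bihomogeneous (strand d A - ds i ! k) (\<Sum>l<length (ds (Suc i)). D i $$ (k, l) * w l)"
        using free_strandD(1)[OF z k] unfolding zw[OF k] .
    qed (rule differential_bihomogeneous[OF k])
    finally show ?thesis using zw[OF k] by simp
  next
    case False
    then show ?thesis using free_strandD(2)[OF z False] by (simp only: differential_def if_False)
  qed
  then have "differential i f = z" by (rule ext)
  then have "z = differential i f" by (rule sym)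
  moreover have "f \<in> free_strand d (Suc i) A"
    by (rule free_strandI) (simp_all add: f_def bihomogeneous_component)
  ultimately show "z \<in> differential i ` free_strand d (Suc i) A" by (rule image_eqI)
qed

text \<open>
  This is where minimality enters: a syzygy is in the image of a matrix with entries in the irrelevant ideal.
\<close>

lemma syzygy_lookup_zero:
  assumes "f \<in> syzygy d i A"
  shows "Poly_Mapping.lookup (f k) 0 = 0"
proof -
  obtain h where f: "f = differential i h"
    using assms unfolding differential_onto[symmetric] by blast
  show ?thesis
  proof (cases "k < length (ds i)")
    case True
    then show ?thesis unfolding f differential_def
      using irrelevant_ideal_lookup_zero[OF minimal[OF True]]
      by (simp add: lookup_sum lookup_mult_zero_left)
  qed (simp add: f differential_def)
qed

lemma koszul_family_free_strand:
  "koszul_family (\<lambda>v f k. variable v * f k) (free_strand d i)"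
proof -
  have "koszul_family (\<lambda>v. (*) (variable v :: ('x, 'y, 'k) bipoly))
      (\<lambda>A. if k < length (ds i) then poly_strand (d - ds i ! k) A else {0})" for k
    using koszul_family_poly_strand[of "d - ds i ! k"] by (cases "k < length (ds i)") (auto simp: koszul_family_def)
  then show ?thesis unfolding free_strand_def by (intro koszul_family_product)
qed

text \<open>
  Coordinate by coordinate, a cycle of syzygies has no constant term at the empty set, so it is a boundary over
  the polynomial ring.
\<close>

lemma koszul_syzygy_cycle_bounds:
  assumes vs: "distinct vs" "set vs = UNIV"
    and c: "\<And>A. c A \<in> syzygy d i A" "koszul (\<lambda>v f k. variable v * f k) vs c = 0"
  shows "\<exists>u. (\<forall>A. u A \<in> free_strand d i A) \<and> koszul (\<lambda>v f k. variable v * f k) vs u = c"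
proof -
  let ?K = "koszul (\<lambda>v. (*) (variable v :: ('x, 'y, 'k) bipoly)) vs"
  let ?M = "\<lambda>k A. if k < length (ds i) then poly_strand (d - ds i ! k) A else {0}
    :: ('x, 'y, 'k) bipoly set"
  have "\<exists>u. (\<forall>A. u A \<in> ?M k A) \<and> ?K u = (\<lambda>A. c A k)" for k
  proof -
    have mem: "c A k \<in> ?M k A" for A
      using syzygy_subset[OF c(1)[of A]] by (auto simp: free_strand_def)
    have "?K (\<lambda>A. c A k) A = 0" for A
      using koszul_product_apply[of "\<lambda>k v. (*) (variable v)" vs c A k] c(2) by simp
    then have cycle: "?K (\<lambda>A. c A k) = 0" by (simp add: fun_eq_iff)
    show ?thesis
    proof (cases "k < length (ds i)")
      case True
      have "\<exists>u. (\<forall>A. u A \<in> poly_strand (d - ds i ! k) A) \<and> ?K u = (\<lambda>A. c A k)"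
        using mem True syzygy_lookup_zero[OF c(1)] by (intro koszul_cycle_bounds vs cycle) auto
      then show ?thesis using True by simp
    next
      case False
      have "koszul_exact (\<lambda>v. (*) (variable v :: ('x, 'y, 'k) bipoly)) vs (\<lambda>A. {0})"
        by (rule koszul_exact_zero[OF commuting_operators_ring])
      then show ?thesis using False mem cycle by (simp add: koszul_exact_def)
    qed
  qed
  then obtain u where u: "\<And>k A. u k A \<in> ?M k A" "\<And>k. ?K (u k) = (\<lambda>A. c A k)" by metis
  have "koszul (\<lambda>v f k. variable v * f k) vs (\<lambda>A k. u k A) = c"
    by (intro ext) (simp only: koszul_product_apply[of "\<lambda>k v. (*) (variable v)"] u(2))
  then show ?thesis using u(1)
    by (intro exI[of _ "\<lambda>A k. u k A"]) (simp add: free_strand_def)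
qed

text \<open>
  Exactness climbs from \<open>I\<close> to all syzygies along the sequences \<open>0 \<rightarrow> Z\<^sub>0 \<rightarrow> F\<^sub>0 \<rightarrow> I \<rightarrow> 0\<close> and
  \<open>0 \<rightarrow> Z\<^sub>i\<^sub>+\<^sub>1 \<rightarrow> F\<^sub>i\<^sub>+\<^sub>1 \<rightarrow> Z\<^sub>i \<rightarrow> 0\<close>, where \<open>Z\<^sub>i\<close> is the kernel of the map out of \<open>F\<^sub>i\<close>.
\<close>

lemma koszul_exact_syzygy:
  assumes vs: "distinct vs" "set vs = UNIV"
    and exact: "koszul_exact (\<lambda>v. (*) (variable v)) vs (ideal_strand I d)"
  shows "koszul_exact (\<lambda>v f k. variable v * f k) vs (syzygy d i)"
proof (induction i)
  case 0
  show ?case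
    by (rule koszul_exact_kernel[OF commuting_operators_times koszul_family_free_strand vs(1)
        additive_augmentation augmentation_times augmentation_onto _ exact
        koszul_syzygy_cycle_bounds[OF vs]]) simp_all
next
  case (Suc i)
  show ?case
    by (rule koszul_exact_kernel[OF commuting_operators_times koszul_family_free_strand vs(1)
        additive_differential differential_times differential_onto _ Suc.IH
        koszul_syzygy_cycle_bounds[OF vs]]) simp_all
qed

lemma koszul_empty_lookup_zero:
  "Poly_Mapping.lookup (koszul (\<lambda>v f k. variable v * f k) vs c {} k :: ('x, 'y, 'k) bipoly) 0 = 0"
  by (induction vs) (simp_all add: lookup_add lookup_variable_times)

text \<open>
  Suppose that \<open>e\<close> is a basis vector of degree \<open>d\<close> of \<open>F\<^sub>i\<^sub>+\<^sub>1\<close>. Its image is a syzygy, and as a chain concentrated at the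
  empty set it is a cycle. By exactness it is a combination of syzygies with the variables as coefficients. Lifting
  these syzygies shows that \<open>e\<close> differs from a syzygy by an element without constant terms. But a syzygy has no
  constant terms either, so neither has \<open>e\<close>, which is absurd.
\<close>

lemma degree_not_in_resolution:
  assumes vs: "distinct vs" "set vs = UNIV"
    and exact: "koszul_exact (\<lambda>v. (*) (variable v)) vs (ideal_strand I d)"
  shows "d \<notin> set (ds (Suc i))"
proof
  assume "d \<in> set (ds (Suc i))"
  then obtain k where k: "k < length (ds (Suc i))" "ds (Suc i) ! k = d"
    by (auto simp: in_set_conv_nth)
  let ?X = "\<lambda>v f k. variable v * f k :: ('x, 'y, 'k) bipoly"
  define e :: "nat \<Rightarrow> ('x, 'y, 'k) bipoly" where "e = (\<lambda>l. if l = k then 1 else 0)"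
  \<comment> \<open>The image of the basis vector, as a chain of homological degree \<open>0\<close>.\<close>
  define c where "c = (\<lambda>A :: ('x + 'y) set. if A = {} then differential i e else 0 :: nat \<Rightarrow> ('x, 'y, 'k) bipoly)"
  have "e \<in> free_strand d (Suc i) {}"
    using k by (intro free_strandI) (auto simp: e_def strand_def bihomogeneous_def map_int_0)
  then have "differential i e \<in> syzygy d i {}" unfolding differential_onto[symmetric] by blast
  moreover have "0 \<in> syzygy d i A" for A
    using koszul_family_zero[OF koszul_family_free_strand, of d "Suc i" A]
      additive.zero[OF additive_differential, of i]
    unfolding differential_onto[symmetric] by (metis image_eqI)
  ultimately have c: "\<forall>A. c A \<in> syzygy d i A" by (simp add: c_def)
  have "koszul ?X vs c A = 0" for A
    by (induction vs arbitrary: A) (auto simp: c_def fun_eq_iff)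
  then have "koszul ?X vs c = 0" by (simp add: fun_eq_iff)
  then obtain u where u: "\<forall>A. u A \<in> syzygy d i A" "koszul ?X vs u = c"
    using koszul_exact_syzygy[OF vs exact, of i] c unfolding koszul_exact_def by blast
  have "\<forall>A. \<exists>f\<in>free_strand d (Suc i) A. differential i f = u A"
    using u(1) unfolding differential_onto[symmetric] by (metis imageE)
  then obtain w where w: "\<And>A. w A \<in> free_strand d (Suc i) A" "\<And>A. differential i (w A) = u A"
    by metis
  have "differential i (koszul ?X vs w {}) = koszul ?X vs u {}"
    using koszul_natural[of "differential i" ?X ?X vs w "{}", OF additive_differential differential_times]
    by (simp add: w(2))
  then have "differential i (e - koszul ?X vs w {}) = 0"
    by (simp add: additive.diff[OF additive_differential] u(2) c_def)
  moreover have "e - koszul ?X vs w {} \<in> free_strand d (Suc i) {}"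
    by (intro koszul_family_diff[OF koszul_family_free_strand]
        koszul_in_family[OF koszul_family_free_strand] w(1)) fact
  ultimately have "e - koszul ?X vs w {} \<in> syzygy d (Suc i) {}" by simp
  then have "Poly_Mapping.lookup ((e - koszul ?X vs w {}) k) 0 = 0" by (rule syzygy_lookup_zero)
  then show False
    using koszul_empty_lookup_zero[of vs w k] by (simp add: e_def lookup_minus)
qed

end

section \<open>The vanishing theorem\<close>

theorem theorem5p8:
  fixes I :: "('x::{finite,linorder}, 'y::finite, 'k::field_char_0) bipoly set"
    and n m :: nat and a b :: int
  assumes "CARD('x) = n + 1" and "CARD('y) = m + 1"
    and "bihomogeneous_ideal I"
    and "(a, b) \<in> x_reg I \<inter> ({0<..} \<times> {0..})"
  shows "\<forall>i\<ge>1. (a + int n + 1, b + int m + 1) \<notin> betti_degrees I i"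
proof (intro allI impI notI)
  fix i :: nat
  let ?d = "(a + int n + 1, b + int m + 1)"
  assume i: "i \<ge> 1" and "?d \<in> betti_degrees I i"
  then obtain ds g D where res: "minimal_bigraded_free_resolution I ds g D"
    and "count_list (ds i) ?d \<noteq> 0"
    by (auto simp: betti_degrees_def)
  then have d: "?d \<in> set (ds i)" by (metis count_list_0_iff)
  have I: "is_ideal I"
    using assms(3) by (auto simp: bihomogeneous_ideal_def is_ideal_def intro: ideal_span_ideal)
  obtain vs :: "('x + 'y) list" where vs: "set vs = UNIV" "distinct vs"
    using finite_distinct_list[OF finite[of UNIV]] by blast
  have "cech_cocycles I (Suc p) (strand ?d A) = cech_diff ` cech_cochains I p (strand ?d A)"
    for p and A :: "('x + 'y) set"
  proof (rule vanishing_cohomology[OF I])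
    obtain a' b' where s: "strand ?d A = (a', b')" by force
    then have "a \<le> a'" "b \<le> b'"
      using strand_ge[where a = a and b = b and A = A] assms(1,2) by (simp_all add: add.assoc)
    then show "x_local_cohomology I (Suc p) (strand ?d A) = {cech_coboundaries I (Suc p) (strand ?d A)}"
      using assms(4) unfolding s x_reg_def by auto
  qed
  then have "koszul_exact (\<lambda>v. (*) (variable v)) vs (ideal_strand I ?d)"
    by (rule koszul_exact_ideal_strand[OF I vs(2,1)])
  then have "?d \<notin> set (ds (Suc (i - 1)))"
    by (rule bigraded_resolution.degree_not_in_resolution[OF bigraded_resolution.intro[OF res] vs(2,1)])
  then show False using d i by simp
qed

end
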